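(* Let $T_0:X\to X$ be a $C^5$ expanding map of the circle $X=\mathbb{R}/\mathbb{Z}$ with transfer operator $\mathcal{L}_0$ and invariant density $\rho$, and let $\rho^{(1)}\in C^3(X,\mathbb{R})$. Let $a,b,c,d\ge 0$ with $d>0$, and for $f\in H^4(X)$ put $$\|f\|_{abcd}=\|f\|_2+a\|f'\|_2+b\|f''\|_2+c\|f'''\|_2+d\|f''''\|_2 .$$ Then among all $\epsilon\in H^4(X)$ satisfying $$(I-\mathcal{L}_0)\rho^{(1)}=\mathcal{L}_0\left(-\frac{\rho\,\epsilon'}{T_0'}-\frac{\epsilon\,\rho'}{T_0'}+\frac{\epsilon\,T_0''}{(T_0')^2}\,\rho\right)$$ there is a unique one of minimal $\|\cdot\|_{abcd}$ norm, i.e. the function $\epsilon \mapsto\|\epsilon\|_{abcd}$ on the set of $H^4$ solutions attains its minimum at exactly one element.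
   Context: An expanding map of the circle $X=\mathbb{R}/\mathbb{Z}$ is an orientation preserving $C^1$ map $T:X\to X$ of degree at least $2$ with $\inf_{x\in X} T'(x)>1$. Its transfer operator is $\mathcal{L}_0 w(x)=\sum_{T_0(y)=x} w(y)/T_0'(y)$, and its invariant density is the unique probability density $\rho$ with $\mathcal{L}_0\rho=\rho$ (it is of class $C^{4}$ when $T_0$ is $C^5$). $\|\cdot\|_2$ is the norm of $L^2(X)$ with respect to Lebesgue measure, and $H^4(X)$ is the Sobolev space of real valued functions on $X$ with weak derivatives up to order four in $L^2(X)$. *)

theory Defs
  imports "HOL-Analysis.Analysis" "HOL-Library.Periodic_Fun"
begin

text \<open>
  Functions on the circle \<open>X = \<real>/\<int>\<close> are represented by 1-periodic functions on \<open>\<real>\<close>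
  (the library predicate \<^const>\<open>periodic_fun_simple'\<close>), points of \<open>X\<close> by their representatives
  in \<open>[0,1)\<close>, and self-maps of \<open>X\<close> by their lifts to \<open>\<real>\<close>. Elements of \<open>L\<^sup>2(X)\<close> and \<open>H\<^sup>k(X)\<close> are
  represented by functions, not by classes, so equality between them is equality almost everywhere.
\<close>

abbreviation circle_measure :: "real measure" where
  "circle_measure \<equiv> lebesgue_on {0..<1}"

definition C_k :: "nat \<Rightarrow> (real \<Rightarrow> real) \<Rightarrow> bool" where
  "C_k k f \<longleftrightarrow>
     (\<forall>j<k. \<forall>x. (deriv ^^ j) f field_differentiable (at x)) \<and>
     continuous_on UNIV ((deriv ^^ k) f)"

definition C_k_circle :: "nat \<Rightarrow> (real \<Rightarrow> real) \<Rightarrow> bool" where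
  "C_k_circle k f \<longleftrightarrow> periodic_fun_simple' f \<and> C_k k f"

text \<open>
  \<open>T\<close> is a lift of a circle map of degree \<open>m\<close> iff it is continuous and \<open>T (x + 1) = T x + m\<close>. The
  bound \<open>c\<close> expresses \<open>inf T' > 1\<close>; orientation preservation is \<open>T' > 0\<close> and so is implied by it.
\<close>

definition expanding_circle_map :: "(real \<Rightarrow> real) \<Rightarrow> bool" where
  "expanding_circle_map T \<longleftrightarrow>
     C_k 1 T \<and>
     (\<exists>m::nat. m \<ge> 2 \<and> (\<forall>x. T (x + 1) = T x + real m)) \<and>
     (\<exists>c>1. \<forall>x. deriv T x \<ge> c)"

definition transfer_operator :: "(real \<Rightarrow> real) \<Rightarrow> (real \<Rightarrow> real) \<Rightarrow> real \<Rightarrow> real" where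
  "transfer_operator T w x = (\<Sum>y\<in>{y \<in> {0..<1}. T y - x \<in> \<int>}. w y / deriv T y)"

definition invariant_density :: "(real \<Rightarrow> real) \<Rightarrow> (real \<Rightarrow> real) \<Rightarrow> bool" where
  "invariant_density T \<rho> \<longleftrightarrow>
     periodic_fun_simple' \<rho> \<and>
     integrable circle_measure \<rho> \<and>
     (AE x in circle_measure. 0 \<le> \<rho> x) \<and>
     (LINT x|circle_measure. \<rho> x) = 1 \<and>
     (AE x in circle_measure. transfer_operator T \<rho> x = \<rho> x)"

definition L2_circle :: "(real \<Rightarrow> real) \<Rightarrow> bool" where
  "L2_circle f \<longleftrightarrow>
     periodic_fun_simple' f \<and>
     f \<in> borel_measurable circle_measure \<and>
     integrable circle_measure (\<lambda>x. (f x)\<^sup>2)"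

definition norm_L2 :: "(real \<Rightarrow> real) \<Rightarrow> real" where
  "norm_L2 f = sqrt (LINT x|circle_measure. (f x)\<^sup>2)"

definition is_weak_deriv :: "nat \<Rightarrow> (real \<Rightarrow> real) \<Rightarrow> (real \<Rightarrow> real) \<Rightarrow> bool" where
  "is_weak_deriv k f g \<longleftrightarrow>
     (\<forall>\<phi>. (\<forall>n. C_k_circle n \<phi>) \<longrightarrow>
        (LINT x|circle_measure. f x * (deriv ^^ k) \<phi> x) =
        (-1) ^ k * (LINT x|circle_measure. g x * \<phi> x))"

definition sobolev_H :: "nat \<Rightarrow> (real \<Rightarrow> real) \<Rightarrow> bool" where
  "sobolev_H k f \<longleftrightarrow> L2_circle f \<and> (\<forall>j\<in>{1..k}. \<exists>g. L2_circle g \<and> is_weak_deriv j f g)"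

text \<open>
  The weak derivative of order \<open>k\<close> in \<open>L\<^sup>2(X)\<close>. It is unique up to null sets, and all uses
  below are insensitive to the choice of representative.
\<close>

definition weak_deriv :: "nat \<Rightarrow> (real \<Rightarrow> real) \<Rightarrow> real \<Rightarrow> real" where
  "weak_deriv k f = (SOME g. L2_circle g \<and> is_weak_deriv k f g)"

definition norm_abcd :: "real \<Rightarrow> real \<Rightarrow> real \<Rightarrow> real \<Rightarrow> (real \<Rightarrow> real) \<Rightarrow> real" where
  "norm_abcd a b c d f =
     norm_L2 f + a * norm_L2 (weak_deriv 1 f) + b * norm_L2 (weak_deriv 2 f) +
     c * norm_L2 (weak_deriv 3 f) + d * norm_L2 (weak_deriv 4 f)"

text \<open>
  The equation for \<open>\<epsilon>\<close>, as an identity in \<open>L\<^sup>2(X)\<close>; \<open>\<rho>1\<close> stands for \<open>\<rho>\<^sup>(\<^sup>1\<^sup>)\<close>.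
\<close>

definition response_equation ::
  "(real \<Rightarrow> real) \<Rightarrow> (real \<Rightarrow> real) \<Rightarrow> (real \<Rightarrow> real) \<Rightarrow> (real \<Rightarrow> real) \<Rightarrow> bool" where
  "response_equation T \<rho> \<rho>1 \<epsilon> \<longleftrightarrow>
     (AE x in circle_measure.
        \<rho>1 x - transfer_operator T \<rho>1 x =
        transfer_operator T
          (\<lambda>y. - (\<rho> y * weak_deriv 1 \<epsilon> y / deriv T y)
               - \<epsilon> y * deriv \<rho> y / deriv T y
               + \<epsilon> y * deriv (deriv T) y / (deriv T y)\<^sup>2 * \<rho> y) x)"

end

theory Submission
  imports Defs
begin

text \<open>
  \<^emph>\<open>Solvability.\<close> The equation says \<open>(\<L> (\<rho> \<epsilon>))' = - (\<rho>1 - \<L> \<rho>1)\<close>. With a periodic primitive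
  \<open>F\<close> of \<open>\<rho>1 - \<L> \<rho>1\<close>, the \<open>C\<^sup>4\<close> function \<open>\<epsilon> = - (F / \<rho>) \<circ> T\<close> is a solution, because
  \<open>\<L> (\<rho> \<epsilon>) = - (F / \<rho>) \<L> \<rho> = - F\<close>.

  \<^emph>\<open>Existence of a minimizer.\<close> The solutions form a convex set. Along a minimizing sequence
  the norms of \<open>f\<close> and \<open>f\<^sup>(\<^sup>4\<^sup>)\<close> are bounded, so they converge on a subsequence. As midpoints of
  solutions are solutions, the parallelogram law then makes \<open>f\<close> and \<open>f\<^sup>(\<^sup>4\<^sup>)\<close> Cauchy in \<open>L\<^sup>2\<close>,
  without any appeal to weak compactness. The other derivatives are iterated mean-zero primitives
  of \<open>f\<^sup>(\<^sup>4\<^sup>)\<close> and so converge too. The equation passes to the limit because \<open>T\<close> maps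
  null sets to null sets.

  \<^emph>\<open>Uniqueness.\<close> Equality in the triangle inequality for \<open>\<parallel>\<cdot>\<parallel>\<^sub>2\<close> forces two minimizers to be
  proportional, and their equal norms force the factor to be one.
\<close>

section \<open>Square-integrable functions\<close>

text \<open>The functional is a sum of norms, not of squares, and need not come from an inner
  product. The parallelogram law is therefore applied to one order of differentiation at a time:
  every order contributes a nonnegative midpoint defect, so each weighted defect is at most the
  defect of the whole norm. Since \<open>a\<close>, \<open>b\<close>, \<open>c\<close> may vanish,
  only orders 0 and 4 are known to carry positive weight, which is why the intermediate derivatives
  have to be recovered from the fourth one. The pullback by T in the explicit solution comes from
  the identity L((u o T) v) = u L v. With v = \<rho> it reaches every multiple of \<rho>, hence
  every function once \<rho> > 0, and positivity is forced by expansion. The primitive F is periodic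
  because L preserves integrals. \<open>weak_deriv\<close> is a choice among almost everywhere equal
  candidates, whereas the transfer operator samples single points. The two are reconciled by
  discarding those x that have a preimage in a given null set.\<close>

definition square_integrable :: "'a measure \<Rightarrow> ('a \<Rightarrow> real) \<Rightarrow> bool" where
  "square_integrable M f \<longleftrightarrow> f \<in> borel_measurable M \<and> integrable M (\<lambda>x. (f x)\<^sup>2)"

definition l2norm :: "'a measure \<Rightarrow> ('a \<Rightarrow> real) \<Rightarrow> real" where
  "l2norm M f = sqrt (LINT x|M. (f x)\<^sup>2)"

lemma square_integrable_measurable [measurable_dest]:
  "square_integrable M f \<Longrightarrow> f \<in> borel_measurable M"
  by (simp add: square_integrable_def)

lemma l2norm_nonneg [simp]: "l2norm M f \<ge> 0"
  by (simp add: l2norm_def)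

lemma l2norm_sq: "(l2norm M f)\<^sup>2 = (LINT x|M. (f x)\<^sup>2)"
  by (simp add: l2norm_def)

lemma square_integrable_mult:
  assumes "square_integrable M f" "square_integrable M g"
  shows "integrable M (\<lambda>x. f x * g x)"
proof (rule Bochner_Integration.integrable_bound)
  show "integrable M (\<lambda>x. (f x)\<^sup>2 + (g x)\<^sup>2)"
    using assms by (simp add: square_integrable_def)
  show "(\<lambda>x. f x * g x) \<in> borel_measurable M"
    using assms by (intro borel_measurable_times square_integrable_measurable)
  have "\<bar>u * v\<bar> \<le> u\<^sup>2 + v\<^sup>2" for u v :: real
  proof -
    have "2 * (\<bar>u\<bar> * \<bar>v\<bar>) \<le> u\<^sup>2 + v\<^sup>2"
      using sum_squares_bound[of "\<bar>u\<bar>" "\<bar>v\<bar>"] by simp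
    moreover have "0 \<le> \<bar>u\<bar> * \<bar>v\<bar>" by simp
    ultimately show ?thesis unfolding abs_mult by linarith
  qed
  then show "AE x in M. norm (f x * g x) \<le> norm ((f x)\<^sup>2 + (g x)\<^sup>2)"
    by simp
qed

lemma square_integrable_scale: "square_integrable M f \<Longrightarrow> square_integrable M (\<lambda>x. c * f x)"
  unfolding square_integrable_def power_mult_distrib
  by (intro conjI borel_measurable_times borel_measurable_const integrable_mult_right) auto

lemma square_integrable_add:
  assumes "square_integrable M f" "square_integrable M g"
  shows "square_integrable M (\<lambda>x. f x + g x)"
  using assms square_integrable_mult[OF assms]
  by (auto simp: square_integrable_def power2_sum mult.assoc)

lemma square_integrable_diff:
  assumes "square_integrable M f" "square_integrable M g"
  shows "square_integrable M (\<lambda>x. f x - g x)"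
  using square_integrable_add[OF assms(1) square_integrable_scale[OF assms(2), of "-1"]] by simp

lemma l2norm_scale: "l2norm M (\<lambda>x. c * f x) = \<bar>c\<bar> * l2norm M f"
  by (simp add: l2norm_def power_mult_distrib real_sqrt_mult)

lemma l2norm_cong_AE:
  assumes "f \<in> borel_measurable M" "g \<in> borel_measurable M" "AE x in M. f x = g x"
  shows "l2norm M f = l2norm M g"
proof -
  have "(LINT x|M. (f x)\<^sup>2) = (LINT x|M. (g x)\<^sup>2)"
    by (rule integral_cong_AE) (use assms in auto)
  then show ?thesis by (simp add: l2norm_def)
qed

lemma l2norm_eq_0_iff:
  assumes "square_integrable M f"
  shows "l2norm M f = 0 \<longleftrightarrow> (AE x in M. f x = 0)"
  using assms integral_nonneg_eq_0_iff_AE[of M "\<lambda>x. (f x)\<^sup>2"]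
  by (simp add: l2norm_def square_integrable_def)

lemma l2norm_sq_lincomb:
  assumes "square_integrable M f" "square_integrable M g"
  shows "(l2norm M (\<lambda>x. s * f x + t * g x))\<^sup>2 =
    s\<^sup>2 * (l2norm M f)\<^sup>2 + 2 * s * t * (LINT x|M. f x * g x) + t\<^sup>2 * (l2norm M g)\<^sup>2"
proof -
  have "(LINT x|M. (s * f x + t * g x)\<^sup>2) =
        (LINT x|M. s\<^sup>2 * (f x)\<^sup>2 + (2 * s * t * (f x * g x) + t\<^sup>2 * (g x)\<^sup>2))"
    by (simp add: power2_eq_square algebra_simps)
  also have "\<dots> = s\<^sup>2 * (LINT x|M. (f x)\<^sup>2) + (2 * s * t * (LINT x|M. f x * g x) + t\<^sup>2 * (LINT x|M. (g x)\<^sup>2))"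
    using assms square_integrable_mult[OF assms] by (simp add: square_integrable_def)
  finally show ?thesis by (simp add: l2norm_sq)
qed

lemma l2norm_cauchy_schwarz:
  assumes "square_integrable M f" "square_integrable M g"
  shows "\<bar>LINT x|M. f x * g x\<bar> \<le> l2norm M f * l2norm M g"
proof (cases "l2norm M f = 0")
  case True
  then have "AE x in M. f x * g x = 0"
    using l2norm_eq_0_iff[OF assms(1)] by auto
  then have "(LINT x|M. f x * g x) = 0"
    by (rule integral_eq_zero_AE)
  then show ?thesis by simp
next
  case False
  define F G I where "F = l2norm M f" and "G = l2norm M g" and "I = (LINT x|M. f x * g x)"
  have "F > 0" unfolding F_def using False l2norm_nonneg[of M f] order_le_neq_trans by metis
  \<comment> \<open>The combination is \<open>F\<close>^2 times the component of \<open>g\<close>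
    orthogonal to \<open>f\<close>; clearing the denominator keeps the expansion polynomial.\<close>
  have "0 \<le> (l2norm M (\<lambda>x. (-I) * f x + F\<^sup>2 * g x))\<^sup>2" by simp
  also have "\<dots> = F\<^sup>2 * (F\<^sup>2 * G\<^sup>2 - I\<^sup>2)"
    unfolding l2norm_sq_lincomb[OF assms] F_def[symmetric] G_def[symmetric] I_def[symmetric]
    by algebra
  finally have "I\<^sup>2 \<le> (F * G)\<^sup>2"
    using \<open>F > 0\<close> by (simp add: zero_le_mult_iff power_mult_distrib)
  then show ?thesis
    by (simp add: F_def G_def I_def abs_le_square_iff[symmetric])
qed

lemma l2norm_triangle:
  assumes "square_integrable M f" "square_integrable M g"
  shows "l2norm M (\<lambda>x. f x + g x) \<le> l2norm M f + l2norm M g"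
proof (rule power2_le_imp_le)
  show "(l2norm M (\<lambda>x. f x + g x))\<^sup>2 \<le> (l2norm M f + l2norm M g)\<^sup>2"
    using l2norm_sq_lincomb[OF assms, of 1 1] l2norm_cauchy_schwarz[OF assms]
    by (simp add: power2_sum)
qed simp

lemma l2norm_triangle_diff:
  assumes "square_integrable M f" "square_integrable M g"
  shows "\<bar>l2norm M f - l2norm M g\<bar> \<le> l2norm M (\<lambda>x. f x - g x)"
proof -
  have "l2norm M f \<le> l2norm M (\<lambda>x. f x - g x) + l2norm M g"
    using l2norm_triangle[OF square_integrable_diff[OF assms] assms(2)] by simp
  moreover have "l2norm M g \<le> l2norm M (\<lambda>x. g x - f x) + l2norm M f"
    using l2norm_triangle[OF square_integrable_diff[OF assms(2,1)] assms(1)] by simp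
  moreover have "l2norm M (\<lambda>x. g x - f x) = l2norm M (\<lambda>x. f x - g x)"
    by (simp add: l2norm_def power2_commute)
  ultimately show ?thesis by linarith
qed

text \<open>Written with the midpoint because a lower bound on the norm of the midpoint is what
  minimality provides; it becomes an upper bound on the distance.\<close>

lemma l2norm_parallelogram:
  assumes "square_integrable M f" "square_integrable M g"
  shows "(l2norm M (\<lambda>x. f x - g x))\<^sup>2 =
    2 * (l2norm M f)\<^sup>2 + 2 * (l2norm M g)\<^sup>2 - 4 * (l2norm M (\<lambda>x. (f x + g x) / 2))\<^sup>2"
  using l2norm_sq_lincomb[OF assms, of 1 "-1"] l2norm_sq_lincomb[OF assms, of "1/2" "1/2"]
  by (simp add: add_divide_distrib power2_eq_square)

text \<open>Squaring the hypothesis gives equality in Cauchy-Schwarz, so ||G f - F g||^2 = 2 F^2 G^2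
  - 2 (F G)^2 = 0 for the norms F, G of f, g. Products in place of a quotient keep vanishing norms
  in scope.\<close>

lemma l2norm_triangle_equality:
  assumes "square_integrable M f" "square_integrable M g"
    and "l2norm M (\<lambda>x. (f x + g x) / 2) = (l2norm M f + l2norm M g) / 2"
  shows "AE x in M. l2norm M g * f x = l2norm M f * g x"
proof -
  define F G where "F = l2norm M f" and "G = l2norm M g"
  have fg: "(LINT x|M. f x * g x) = F * G"
    using l2norm_sq_lincomb[OF assms(1,2), of "1/2" "1/2"] assms(3)
    by (simp add: add_divide_distrib F_def G_def power2_eq_square algebra_simps)
  have "(l2norm M (\<lambda>x. G * f x + (- F) * g x))\<^sup>2 = 0"
    unfolding l2norm_sq_lincomb[OF assms(1,2)] fg F_def[symmetric] G_def[symmetric]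
    by algebra
  then have "l2norm M (\<lambda>x. G * f x - F * g x) = 0"
    by simp
  moreover have "square_integrable M (\<lambda>x. G * f x - F * g x)"
    using assms by (intro square_integrable_diff square_integrable_scale)
  ultimately have "AE x in M. G * f x - F * g x = 0"
    using l2norm_eq_0_iff by blast
  then show ?thesis by (simp add: F_def G_def)
qed

text \<open>The squares tend to 0 in L^1, and L^1 convergence yields an almost everywhere convergent
  subsequence.\<close>

lemma l2norm_tendsto_0_AE_subseq:
  assumes "\<And>n. square_integrable M (u n)" "(\<lambda>n. l2norm M (u n)) \<longlonglongrightarrow> 0"
  shows "\<exists>r::nat \<Rightarrow> nat. strict_mono r \<and> (AE x in M. (\<lambda>n. u (r n) x) \<longlonglongrightarrow> 0)"
proof -
  have "\<exists>r::nat \<Rightarrow> nat. strict_mono r \<and> (AE x in M. (\<lambda>n. (u (r n) x)\<^sup>2) \<longlonglongrightarrow> 0)"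
  proof (rule tendsto_L1_AE_subseq)
    show "integrable M (\<lambda>x. (u n x)\<^sup>2)" for n
      using assms(1)[of n] by (simp add: square_integrable_def)
    show "(\<lambda>n. LINT x|M. norm ((u n x)\<^sup>2)) \<longlonglongrightarrow> 0"
      using tendsto_power[OF assms(2), of 2] by (simp add: l2norm_sq)
  qed
  then obtain r where r: "strict_mono (r::nat \<Rightarrow> nat)" "AE x in M. (\<lambda>n. (u (r n) x)\<^sup>2) \<longlonglongrightarrow> 0"
    by blast
  have "v \<longlonglongrightarrow> 0" if "(\<lambda>n. (v n)\<^sup>2) \<longlonglongrightarrow> 0" for v :: "nat \<Rightarrow> real"
    using tendsto_real_sqrt[OF that] by (simp add: tendsto_rabs_zero_iff)
  then show ?thesis using r by auto
qed

section \<open>Completeness of L^2 over a finite measure\<close>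

context finite_measure
begin

lemma square_integrable_const: "square_integrable M (\<lambda>x. c)"
  by (simp add: square_integrable_def)

lemma square_integrable_integrable: "square_integrable M f \<Longrightarrow> integrable M f"
  using square_integrable_mult[OF _ square_integrable_const[of 1]] by simp

lemma square_integrable_bounded:
  assumes "f \<in> borel_measurable M" "\<And>x. x \<in> space M \<Longrightarrow> \<bar>f x\<bar> \<le> B"
  shows "square_integrable M f"
  unfolding square_integrable_def
proof (intro conjI assms integrable_const_bound[of _ "B\<^sup>2"])
  have "(f x)\<^sup>2 \<le> B\<^sup>2" if "x \<in> space M" for x
    using power_mono[OF assms(2)[OF that], of 2] by simp
  then show "AE x in M. norm ((f x)\<^sup>2) \<le> B\<^sup>2" by simp
qed (use assms(1) in measurable)

lemma L1_le_l2norm: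
  assumes "square_integrable M f"
  shows "(LINT x|M. \<bar>f x\<bar>) \<le> sqrt (measure M (space M)) * l2norm M f"
proof -
  have "square_integrable M (\<lambda>x. \<bar>f x\<bar>)"
    using assms unfolding square_integrable_def power2_abs
    by (intro conjI borel_measurable_abs) auto
  from l2norm_cauchy_schwarz[OF square_integrable_const[of 1] this] show ?thesis
    by (simp add: l2norm_def)
qed

text \<open>Riesz-Fischer. Along a fast subsequence the increments are summable in L^2, hence in L^1
  because the measure is finite; this gives almost everywhere convergence, and Fatou turns it into
  L^2 convergence.\<close>

theorem square_integrable_complete:
  assumes f: "\<And>n::nat. square_integrable M (f n)"
    and Cauchy: "\<And>e. e > 0 \<Longrightarrow> \<exists>N. \<forall>m\<ge>N. \<forall>n\<ge>N. l2norm M (\<lambda>x. f m x - f n x) < e"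
  shows "\<exists>g. square_integrable M g \<and> (\<lambda>n. l2norm M (\<lambda>x. f n x - g x)) \<longlonglongrightarrow> 0"
proof -
  note [measurable] = square_integrable_measurable[OF f]
  obtain N where N: "\<And>k m n. m \<ge> N k \<Longrightarrow> n \<ge> N k \<Longrightarrow> l2norm M (\<lambda>x. f m x - f n x) < (1/2)^k"
    using Cauchy[of "(1/2)^_"] by (metis zero_less_power half_gt_zero zero_less_one)
  \<comment> \<open>The partial sum puts both \<open>r k\<close> and \<open>r (Suc k)\<close> above
    \<open>N k\<close>, so the k-th increment has norm below (1/2)^k; the summand \<open>k\<close>
    makes \<open>r\<close> tend to infinity.\<close>
  define r where "r k = k + (\<Sum>i\<le>k. N i)" for k
  have r_ge: "r k \<ge> N k" "r k \<ge> k" for k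
    using member_le_sum[of k "{..k}" N] by (auto simp: r_def)
  have r_Suc: "r (Suc k) \<ge> N k" for k
    using member_le_sum[of k "{..Suc k}" N] by (auto simp: r_def)
  define u where "u k x = f (r (Suc k)) x - f (r k) x" for k x
  have u [simp]: "square_integrable M (u k)" for k
    unfolding u_def by (intro square_integrable_diff f)
  note [measurable] = square_integrable_measurable[OF u]
  define C where "C = sqrt (measure M (space M))"
  have "C \<ge> 0" by (simp add: C_def)
  have L1u: "(LINT x|M. \<bar>u k x\<bar>) \<le> C * (1/2)^k" for k
  proof -
    have "(LINT x|M. \<bar>u k x\<bar>) \<le> C * l2norm M (u k)"
      unfolding C_def by (rule L1_le_l2norm[OF u])
    also have "l2norm M (u k) \<le> (1/2)^k"
      unfolding u_def using N[OF r_Suc r_ge(1), of k] by simp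
    finally show ?thesis using \<open>C \<ge> 0\<close> by (simp add: mult_left_mono)
  qed
  have "(\<integral>\<^sup>+x. (\<Sum>k. ennreal \<bar>u k x\<bar>) \<partial>M) = (\<Sum>k. \<integral>\<^sup>+x. ennreal \<bar>u k x\<bar> \<partial>M)"
    by (rule nn_integral_suminf) measurable
  also have "\<dots> = (\<Sum>k. ennreal (LINT x|M. \<bar>u k x\<bar>))"
    by (intro suminf_cong nn_integral_eq_integral integrable_abs square_integrable_integrable u) auto
  also have "\<dots> \<le> (\<Sum>k. ennreal (C * (1/2)^k))"
    by (intro suminf_le ennreal_leI L1u) auto
  also have "\<dots> = ennreal (\<Sum>k. C * (1/2)^k)"
    using \<open>C \<ge> 0\<close> by (intro suminf_ennreal2 summable_mult summable_geometric) auto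
  finally have "(\<integral>\<^sup>+x. (\<Sum>k. ennreal \<bar>u k x\<bar>) \<partial>M) \<noteq> \<infinity>"
    by (auto simp: top_unique)
  then have "AE x in M. (\<Sum>k. ennreal \<bar>u k x\<bar>) \<noteq> \<infinity>"
    by (intro nn_integral_PInf_AE) auto
  then have conv: "AE x in M. convergent (\<lambda>k. f (r k) x)"
  proof eventually_elim
    case (elim x)
    have "summable (\<lambda>k. \<bar>u k x\<bar>)"
      using elim by (intro summable_suminf_not_top) auto
    then have "summable (\<lambda>k. u k x)"
      by (rule summable_rabs_cancel)
    then have "convergent (\<lambda>n. \<Sum>k<n. u k x)"
      by (simp add: summable_iff_convergent)
    moreover have "(\<Sum>k<n. u k x) = f (r n) x - f (r 0) x" for n
      unfolding u_def by (rule sum_lessThan_telescope)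
    ultimately show ?case
      using convergent_add_const_right_iff[of "\<lambda>n. f (r n) x" "- f (r 0) x"] by simp
  qed
  define g where "g x = lim (\<lambda>k. f (r k) x)" for x
  have g_meas [measurable]: "g \<in> borel_measurable M"
    unfolding g_def by (rule borel_measurable_lim_metric) measurable
  have lim: "AE x in M. (\<lambda>k. f (r k) x) \<longlonglongrightarrow> g x"
    using conv by eventually_elim (simp add: g_def convergent_LIMSEQ_iff)
  \<comment> \<open>Fatou along \<open>r\<close> estimates every late \<open>f n\<close>, not only
    the subsequence. The bound is on the nonnegative integral, since integrability of the square is
    only deduced from its finiteness.\<close>
  have bound: "(\<integral>\<^sup>+x. ennreal ((f n x - g x)\<^sup>2) \<partial>M) \<le> ennreal (e\<^sup>2)"
    if e: "e > 0" "\<And>m n. m \<ge> K \<Longrightarrow> n \<ge> K \<Longrightarrow> l2norm M (\<lambda>x. f m x - f n x) < e" and "n \<ge> K" for e K n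
  proof -
    have "(\<integral>\<^sup>+x. ennreal ((f n x - g x)\<^sup>2) \<partial>M) =
        (\<integral>\<^sup>+x. liminf (\<lambda>k. ennreal ((f n x - f (r k) x)\<^sup>2)) \<partial>M)"
    proof (rule nn_integral_cong_AE, use lim in eventually_elim)
      case (elim x)
      have "(\<lambda>k. ennreal ((f n x - f (r k) x)\<^sup>2)) \<longlonglongrightarrow> ennreal ((f n x - g x)\<^sup>2)"
        by (intro tendsto_ennrealI tendsto_intros elim)
      then show ?case using lim_imp_Liminf[OF trivial_limit_sequentially] by metis
    qed
    also have "\<dots> \<le> liminf (\<lambda>k. \<integral>\<^sup>+x. ennreal ((f n x - f (r k) x)\<^sup>2) \<partial>M)"
      by (rule nn_integral_liminf) measurable
    also have "\<dots> \<le> ennreal (e\<^sup>2)"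
    proof (rule Liminf_le)
      show "\<forall>\<^sub>F k in sequentially. (\<integral>\<^sup>+x. ennreal ((f n x - f (r k) x)\<^sup>2) \<partial>M) \<le> ennreal (e\<^sup>2)"
      proof (rule eventually_sequentiallyI[of K])
        fix k assume "K \<le> k"
        then have "r k \<ge> K" using r_ge(2)[of k] by simp
        have "(\<integral>\<^sup>+x. ennreal ((f n x - f (r k) x)\<^sup>2) \<partial>M) = ennreal ((l2norm M (\<lambda>x. f n x - f (r k) x))\<^sup>2)"
          unfolding l2norm_sq using square_integrable_diff[OF f f]
          by (intro nn_integral_eq_integral) (auto simp: square_integrable_def)
        also have "\<dots> \<le> ennreal (e\<^sup>2)"
          using e(2)[OF \<open>n \<ge> K\<close> \<open>r k \<ge> K\<close>] by (intro ennreal_leI power_mono) auto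
        finally show "(\<integral>\<^sup>+x. ennreal ((f n x - f (r k) x)\<^sup>2) \<partial>M) \<le> ennreal (e\<^sup>2)" .
      qed
    qed simp
    finally show ?thesis .
  qed
  have si: "square_integrable M (\<lambda>x. f n x - g x)" "l2norm M (\<lambda>x. f n x - g x) \<le> e"
    if "e > 0" "\<And>m n. m \<ge> K \<Longrightarrow> n \<ge> K \<Longrightarrow> l2norm M (\<lambda>x. f m x - f n x) < e" "n \<ge> K" for e K n
  proof -
    note b = bound[OF that]
    then have "integrable M (\<lambda>x. (f n x - g x)\<^sup>2)"
      by (intro integrableI_nonneg) (auto simp: order_le_less_trans)
    then show "square_integrable M (\<lambda>x. f n x - g x)"
      by (simp add: square_integrable_def)
    have "(LINT x|M. (f n x - g x)\<^sup>2) \<le> e\<^sup>2"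
      using b nn_integral_eq_integral[OF \<open>integrable M (\<lambda>x. (f n x - g x)\<^sup>2)\<close>] by simp
    then show "l2norm M (\<lambda>x. f n x - g x) \<le> e"
      using \<open>e > 0\<close> by (simp add: l2norm_def real_le_lsqrt)
  qed
  obtain K where K: "\<And>m n. m \<ge> K \<Longrightarrow> n \<ge> K \<Longrightarrow> l2norm M (\<lambda>x. f m x - f n x) < 1"
    using Cauchy[of 1] by auto
  have "square_integrable M (\<lambda>x. f K x - (f K x - g x))"
    by (intro square_integrable_diff f si(1)[of 1 K] K) auto
  then have "square_integrable M g" by simp
  moreover have "(\<lambda>n. l2norm M (\<lambda>x. f n x - g x)) \<longlonglongrightarrow> 0"
  proof (rule LIMSEQ_I)
    fix e :: real assume "e > 0"
    obtain K where "\<And>m n. m \<ge> K \<Longrightarrow> n \<ge> K \<Longrightarrow> l2norm M (\<lambda>x. f m x - f n x) < e/2"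
      using Cauchy[of "e/2"] \<open>e > 0\<close> by auto
    then have "\<forall>n\<ge>K. l2norm M (\<lambda>x. f n x - g x) \<le> e/2"
      using si(2)[of "e/2" K] \<open>e > 0\<close> by auto
    then show "\<exists>no. \<forall>n\<ge>no. norm (l2norm M (\<lambda>x. f n x - g x) - 0) < e"
      using \<open>e > 0\<close> by (intro exI[of _ K]) fastforce
  qed
  ultimately show ?thesis by blast
qed

end

section \<open>Smooth functions on the circle\<close>

lemma C_k_0: "C_k 0 f \<longleftrightarrow> continuous_on UNIV f"
  by (simp add: C_k_def)

lemma C_k_Suc: "C_k (Suc k) f \<longleftrightarrow> (\<forall>x. f field_differentiable (at x)) \<and> C_k k (deriv f)"
  unfolding C_k_def less_Suc_eq_0_disj funpow_swap1 [of deriv, symmetric]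
  by (auto simp: funpow_swap1)

lemma C_k_SucI:
  assumes "\<And>x. (f has_real_derivative f' x) (at x)" "C_k k f'"
  shows "C_k (Suc k) f"
proof -
  have "deriv f = f'" using assms(1) by (auto intro: DERIV_imp_deriv)
  then show ?thesis
    using assms unfolding C_k_Suc field_differentiable_def by auto
qed

lemma C_k_Suc_DERIV: "C_k (Suc k) f \<Longrightarrow> (f has_real_derivative deriv f x) (at x)"
  by (simp add: C_k_Suc DERIV_deriv_iff_field_differentiable)

lemma C_k_deriv: "C_k (Suc k) f \<Longrightarrow> C_k k (deriv f)"
  by (simp add: C_k_Suc)

lemma C_k_SucD: "C_k (Suc k) f \<Longrightarrow> C_k k f"
proof (induction k arbitrary: f)
  case 0
  then show ?case
    by (auto simp: C_k_0 C_k_Suc continuous_on_eq_continuous_at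
        intro: field_differentiable_imp_continuous_at)
next
  case (Suc k)
  then show ?case by (metis C_k_Suc)
qed

lemma C_k_mono: "C_k n f \<Longrightarrow> m \<le> n \<Longrightarrow> C_k m f"
  by (induction n) (auto simp: le_Suc_eq dest: C_k_SucD)

lemma C_k_continuous: "C_k n f \<Longrightarrow> continuous_on A f"
  using C_k_mono[of n f 0] continuous_on_subset by (auto simp: C_k_0)

lemma C_k_const: "C_k n (\<lambda>x. c)"
proof (induction n arbitrary: c)
  case (Suc n)
  show ?case by (rule C_k_SucI[OF _ Suc[of 0]]) auto
qed (simp add: C_k_0)

lemma C_k_ident: "C_k n (\<lambda>x. x)"
proof (cases n)
  case (Suc m)
  show ?thesis unfolding Suc by (rule C_k_SucI[OF _ C_k_const[of _ 1]]) auto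
qed (simp add: C_k_0)

lemma C_k_add: "C_k n f \<Longrightarrow> C_k n g \<Longrightarrow> C_k n (\<lambda>x. f x + g x)"
proof (induction n arbitrary: f g)
  case (Suc n)
  show ?case
    by (rule C_k_SucI[where f' = "\<lambda>x. deriv f x + deriv g x"])
      (use Suc in \<open>auto intro!: derivative_eq_intros C_k_Suc_DERIV C_k_deriv\<close>)
qed (auto simp: C_k_0 intro: continuous_intros)

lemma C_k_mult: "C_k n f \<Longrightarrow> C_k n g \<Longrightarrow> C_k n (\<lambda>x. f x * g x)"
proof (induction n arbitrary: f g)
  case (Suc n)
  have D: "((\<lambda>x. f x * g x) has_real_derivative (deriv f x * g x + f x * deriv g x)) (at x)" for x
    using DERIV_mult[OF C_k_Suc_DERIV[OF Suc.prems(1)] C_k_Suc_DERIV[OF Suc.prems(2)]]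
    by (simp add: algebra_simps)
  show ?case
    using Suc.IH[OF C_k_deriv[OF Suc.prems(1)] C_k_SucD[OF Suc.prems(2)]]
      Suc.IH[OF C_k_SucD[OF Suc.prems(1)] C_k_deriv[OF Suc.prems(2)]]
    by (intro C_k_SucI[OF D] C_k_add)
qed (auto simp: C_k_0 intro: continuous_intros)

lemma C_k_diff: "C_k n f \<Longrightarrow> C_k n g \<Longrightarrow> C_k n (\<lambda>x. f x - g x)"
  using C_k_add[of n f "\<lambda>x. (-1) * g x"] C_k_mult[OF C_k_const[of n "-1"], of g] by simp

lemma C_k_minus: "C_k n f \<Longrightarrow> C_k n (\<lambda>x. - f x)"
  using C_k_diff[OF C_k_const[of n 0], of f] by simp

lemma C_k_sum: "(\<And>i. i \<in> I \<Longrightarrow> C_k n (f i)) \<Longrightarrow> C_k n (\<lambda>x. \<Sum>i\<in>I. f i x)"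
  by (induction I rule: infinite_finite_induct) (auto intro: C_k_add C_k_const)

lemma C_k_compose: "C_k n f \<Longrightarrow> C_k n g \<Longrightarrow> C_k n (\<lambda>x. f (g x))"
proof (induction n arbitrary: f g)
  case 0
  then show ?case using continuous_on_compose2[of UNIV f UNIV g] by (simp add: C_k_0)
next
  case (Suc n)
  have D: "((\<lambda>x. f (g x)) has_real_derivative (deriv f (g x) * deriv g x)) (at x)" for x
    by (rule DERIV_chain2) (use Suc.prems C_k_Suc_DERIV in auto)
  show ?case
    using Suc.IH[OF C_k_deriv[OF Suc.prems(1)] C_k_SucD[OF Suc.prems(2)]] C_k_deriv[OF Suc.prems(2)]
    by (intro C_k_SucI[OF D] C_k_mult)
qed

lemma C_k_reciprocal: "C_k n f \<Longrightarrow> (\<And>x. f x \<noteq> 0) \<Longrightarrow> C_k n (\<lambda>x. 1 / f x)"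
proof (induction n arbitrary: f)
  case (Suc n)
  \<comment> \<open>The derivative is expressed through \<open>1 / f\<close> itself, to which the
    induction hypothesis applies at order \<open>n\<close>.\<close>
  have D: "((\<lambda>x. 1 / f x) has_real_derivative (- (deriv f x * (1 / f x * (1 / f x))))) (at x)" for x
    by (auto intro!: derivative_eq_intros C_k_Suc_DERIV[OF Suc.prems(1)] simp: Suc.prems(2))
  have "C_k n (\<lambda>x. 1 / f x)" using Suc by (auto dest: C_k_SucD)
  then show ?case
    by (intro C_k_SucI[OF D] C_k_minus C_k_mult C_k_deriv[OF Suc.prems(1)])
qed (auto simp: C_k_0 intro: continuous_intros)

lemma C_k_divide: "C_k n f \<Longrightarrow> C_k n g \<Longrightarrow> (\<And>x. g x \<noteq> 0) \<Longrightarrow> C_k n (\<lambda>x. f x / g x)"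
  using C_k_mult[of n f "\<lambda>x. 1 / g x"] C_k_reciprocal[of n g] by simp

lemma C_k_antiderivative:
  assumes "C_k k f"
  obtains F where "\<And>x. (F has_real_derivative f x) (at x)" "C_k (Suc k) F"
proof -
  have "\<exists>F. \<forall>x. (- \<infinity> :: ereal) < x \<longrightarrow> x < \<infinity> \<longrightarrow> (F has_vector_derivative f x) (at x)"
    using C_k_continuous[OF assms, of UNIV]
    by (intro einterval_antiderivative) (auto simp: continuous_on_eq_continuous_at)
  then obtain F where F: "\<And>x. (F has_real_derivative f x) (at x)"
    by (auto simp: has_real_derivative_iff_has_vector_derivative)
  then show ?thesis using C_k_SucI[OF F assms] that by blast
qed

section \<open>Periodic functions and test functions\<close>

lemma periodic_deriv:
  fixes f :: "real \<Rightarrow> real"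
  assumes "periodic_fun_simple' f" "\<And>x. f field_differentiable (at x)"
  shows "periodic_fun_simple' (deriv f)"
proof
  fix x :: real
  have per: "f (x + 1) = f x" for x using assms(1) by (rule periodic_fun_simple'.plus_period)
  have "(f has_real_derivative deriv f (x + 1)) (at (x + 1))"
    using assms(2) by (simp add: DERIV_deriv_iff_field_differentiable)
  then have "((\<lambda>y. f (y + 1)) has_real_derivative deriv f (x + 1)) (at x)"
    by (simp add: DERIV_shift)
  then show "deriv f (x + 1) = deriv f x"
    unfolding per by (metis DERIV_imp_deriv)
qed

lemma periodic_add_int:
  assumes "periodic_fun_simple' f"
  shows "f (x + of_int k) = f (x :: real)"
proof -
  interpret periodic_fun_simple' f by fact
  show ?thesis by (rule plus_of_int)
qed

lemma periodic_frac: "periodic_fun_simple' f \<Longrightarrow> f (frac x) = f (x :: real)"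
  using periodic_add_int[of f x "- \<lfloor>x\<rfloor>"] by (simp add: frac_def)

lemma periodicI_frac: "(\<And>x::real. f (frac x) = f x) \<Longrightarrow> periodic_fun_simple' f"
  by unfold_locales (metis frac_1_eq)

lemma C_k_circle_deriv: "C_k_circle (Suc k) f \<Longrightarrow> C_k_circle k (deriv f)"
  by (simp add: C_k_circle_def C_k_Suc periodic_deriv)

lemma C_k_circle_mono: "C_k_circle n f \<Longrightarrow> m \<le> n \<Longrightarrow> C_k_circle m f"
  by (auto simp: C_k_circle_def intro: C_k_mono)

lemma C_k_circle_derivs: "C_k_circle (m + k) f \<Longrightarrow> C_k_circle m ((deriv ^^ k) f)"
  by (induction k arbitrary: m) (auto intro: C_k_circle_deriv simp flip: add_Suc)

lemma C_k_circle_const: "C_k_circle n (\<lambda>x. c)"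
  by (simp add: C_k_circle_def C_k_const periodic_fun_simple'_def)

lemma C_k_circle_add: "C_k_circle n f \<Longrightarrow> C_k_circle n g \<Longrightarrow> C_k_circle n (\<lambda>x. f x + g x)"
  by (simp add: C_k_circle_def C_k_add periodic_fun_simple'_def)

lemma C_k_circle_mult: "C_k_circle n f \<Longrightarrow> C_k_circle n g \<Longrightarrow> C_k_circle n (\<lambda>x. f x * g x)"
  by (simp add: C_k_circle_def C_k_mult periodic_fun_simple'_def)

text \<open>The class of test functions over which \<open>is_weak_deriv\<close> quantifies.\<close>

definition smooth_circle :: "(real \<Rightarrow> real) \<Rightarrow> bool" where
  "smooth_circle \<phi> \<longleftrightarrow> (\<forall>n. C_k_circle n \<phi>)"

lemma smooth_circle_const: "smooth_circle (\<lambda>x. c)"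
  and smooth_circle_add: "smooth_circle \<phi> \<Longrightarrow> smooth_circle \<psi> \<Longrightarrow> smooth_circle (\<lambda>x. \<phi> x + \<psi> x)"
  and smooth_circle_mult: "smooth_circle \<phi> \<Longrightarrow> smooth_circle \<psi> \<Longrightarrow> smooth_circle (\<lambda>x. \<phi> x * \<psi> x)"
  by (simp_all add: smooth_circle_def C_k_circle_const C_k_circle_add C_k_circle_mult)

lemma smooth_circle_deriv: "smooth_circle \<phi> \<Longrightarrow> smooth_circle (deriv \<phi>)"
  using C_k_circle_deriv by (auto simp: smooth_circle_def)

lemma smooth_circle_derivs: "smooth_circle \<phi> \<Longrightarrow> smooth_circle ((deriv ^^ k) \<phi>)"
  by (induction k) (auto intro: smooth_circle_deriv)

lemma smooth_circle_DERIV: "smooth_circle \<phi> \<Longrightarrow> (\<phi> has_real_derivative deriv \<phi> x) (at x)"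
  using C_k_Suc_DERIV by (auto simp: smooth_circle_def C_k_circle_def)

section \<open>Integration over one period\<close>

lemma finite_measure_circle: "finite_measure circle_measure"
  by (rule finite_measure_lebesgue_on) (simp add: bounded_set_imp_lmeasurable)

lemma measure_circle: "measure circle_measure {0..<1} = 1"
  by (simp add: measure_restrict_space)

interpretation circle: finite_measure circle_measure
  by (rule finite_measure_circle)

lemma circle_integrable_continuous:
  assumes "continuous_on {0..1} f"
  shows "integrable circle_measure (f :: real \<Rightarrow> real)"
    and "(LINT x|circle_measure. f x) = integral {0..1} f"
proof -
  have "f absolutely_integrable_on {0..1}"
    using assms by (rule absolutely_integrable_continuous_real)
  then have a: "f absolutely_integrable_on {0..<1}"
    by (rule set_integrable_subset) auto
  then show i: "integrable circle_measure f"
    by (simp add: integrable_restrict_space set_integrable_def)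
  have "(LINT x|circle_measure. f x) = integral {0..<1} f"
    by (rule lebesgue_integral_eq_integral[OF i]) simp
  also have "\<dots> = integral {0..1} f"
    by (rule integral_subset_negligible) (auto intro!: negligible_subset[of "{1}"])
  finally show "(LINT x|circle_measure. f x) = integral {0..1} f" .
qed

lemma circle_measurable_continuous:
  "continuous_on UNIV f \<Longrightarrow> f \<in> borel_measurable circle_measure" for f :: "real \<Rightarrow> real"
  using continuous_on_subset
  by (intro continuous_imp_measurable_on_sets_lebesgue) auto

lemma C_k_circle_square_integrable:
  assumes "C_k_circle n f"
  shows "square_integrable circle_measure f"
  unfolding square_integrable_def
  using assms C_k_continuous
  by (auto simp: C_k_circle_def intro!: circle_measurable_continuous circle_integrable_continuous(1) continuous_intros)

lemma C_k_circle_integral_deriv: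
  assumes "C_k_circle 1 f"
  shows "(LINT x|circle_measure. deriv f x) = 0"
proof -
  have C: "C_k (Suc 0) f" and per: "f (x + 1) = f x" for x
    using assms by (auto simp: C_k_circle_def periodic_fun_simple'_def)
  have "(deriv f has_integral (f 1 - f 0)) {0..1}"
    using C_k_Suc_DERIV[OF C]
    by (intro fundamental_theorem_of_calculus)
      (auto simp: has_real_derivative_iff_has_vector_derivative[symmetric] intro: DERIV_subset)
  then show ?thesis
    using circle_integrable_continuous(2)[OF C_k_continuous[OF C_k_deriv[OF C]]] per[of 0]
    by (simp add: integral_unique)
qed

lemma C_k_circle_by_parts:
  assumes "C_k_circle 1 f" "C_k_circle 1 g"
  shows "(LINT x|circle_measure. f x * deriv g x) = - (LINT x|circle_measure. deriv f x * g x)"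
proof -
  have C: "C_k (Suc 0) f" "C_k (Suc 0) g" using assms by (auto simp: C_k_circle_def)
  have "deriv (\<lambda>x. f x * g x) = (\<lambda>x. f x * deriv g x + deriv f x * g x)"
    using DERIV_mult[OF C_k_Suc_DERIV[OF C(1)] C_k_Suc_DERIV[OF C(2)]]
    by (intro ext DERIV_imp_deriv) (simp add: algebra_simps)
  then have "0 = (LINT x|circle_measure. f x * deriv g x + deriv f x * g x)"
    using C_k_circle_integral_deriv[OF C_k_circle_mult[OF assms]] by simp
  also have "\<dots> = (LINT x|circle_measure. f x * deriv g x) + (LINT x|circle_measure. deriv f x * g x)"
    using C_k_continuous[OF C(1)] C_k_continuous[OF C(2)]
      C_k_continuous[OF C_k_deriv[OF C(1)]] C_k_continuous[OF C_k_deriv[OF C(2)]]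
    by (intro Bochner_Integration.integral_add circle_integrable_continuous(1) continuous_intros)
  finally show ?thesis by simp
qed

lemma is_weak_derivI:
  assumes "\<And>\<phi>. smooth_circle \<phi> \<Longrightarrow>
    (LINT x|circle_measure. f x * (deriv ^^ k) \<phi> x) = (-1) ^ k * (LINT x|circle_measure. g x * \<phi> x)"
  shows "is_weak_deriv k f g"
  using assms by (auto simp: is_weak_deriv_def smooth_circle_def)

lemma is_weak_derivD:
  assumes "is_weak_deriv k f g" "smooth_circle \<phi>"
  shows "(LINT x|circle_measure. f x * (deriv ^^ k) \<phi> x) = (-1) ^ k * (LINT x|circle_measure. g x * \<phi> x)"
  using assms by (auto simp: is_weak_deriv_def smooth_circle_def)

text \<open>Each integration by parts moves one derivative across, and periodicity removes the
  boundary terms.\<close>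

lemma C_k_circle_is_weak_deriv:
  "C_k_circle k f \<Longrightarrow> is_weak_deriv k f ((deriv ^^ k) f)"
proof (induction k arbitrary: f)
  case 0
  show ?case by (rule is_weak_derivI) simp
next
  case (Suc k)
  show ?case
  proof (rule is_weak_derivI)
    fix \<phi> assume \<phi>: "smooth_circle \<phi>"
    have "C_k_circle 1 ((deriv ^^ k) \<phi>)"
      using smooth_circle_derivs[OF \<phi>] by (simp add: smooth_circle_def)
    moreover have "C_k_circle 1 f" using Suc.prems C_k_circle_mono by force
    ultimately have "(LINT x|circle_measure. f x * (deriv ^^ Suc k) \<phi> x) =
        - (LINT x|circle_measure. deriv f x * (deriv ^^ k) \<phi> x)"
      using C_k_circle_by_parts by simp
    also have "\<dots> = - ((-1) ^ k * (LINT x|circle_measure. (deriv ^^ k) (deriv f) x * \<phi> x))"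
      using is_weak_derivD[OF Suc.IH[OF C_k_circle_deriv[OF Suc.prems]] \<phi>] by simp
    finally show "(LINT x|circle_measure. f x * (deriv ^^ Suc k) \<phi> x) =
        (-1) ^ Suc k * (LINT x|circle_measure. (deriv ^^ Suc k) f x * \<phi> x)"
      by (simp add: funpow_swap1)
  qed
qed

text \<open>Zero mean is what makes the primitive periodic. Its own mean is subtracted so that the
  construction can be repeated.\<close>

lemma smooth_circle_antiderivative:
  assumes "smooth_circle \<phi>" "(LINT x|circle_measure. \<phi> x) = 0"
  shows "\<exists>\<psi>. smooth_circle \<psi> \<and> deriv \<psi> = \<phi> \<and> (LINT x|circle_measure. \<psi> x) = 0"
proof -
  have C\<phi>: "C_k n \<phi>" and per\<phi>: "\<phi> (x + 1) = \<phi> x" for n x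
    using assms(1) by (auto simp: smooth_circle_def C_k_circle_def periodic_fun_simple'_def)
  obtain F where F: "\<And>x. (F has_real_derivative \<phi> x) (at x)"
    using C_k_antiderivative[OF C\<phi>] by blast
  have CF: "C_k n F" for n
    using C_k_SucD[OF C_k_SucI[OF F C\<phi>]] .
  have "(\<phi> has_integral (F 1 - F 0)) {0..1}"
    using F by (intro fundamental_theorem_of_calculus)
      (auto simp: has_real_derivative_iff_has_vector_derivative[symmetric] intro: DERIV_subset)
  then have F01: "F 1 = F 0"
    using circle_integrable_continuous(2)[OF C_k_continuous[OF C\<phi>]] assms(2)
    by (simp add: integral_unique)
  \<comment> \<open>The increment over a period is constant by periodicity of \<open>\<phi>\<close>,
    and equals the integral of \<open>\<phi>\<close>, which is 0.\<close>
  have "((\<lambda>y. F (y + 1) - F y) has_real_derivative 0) (at x)" for x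
    using F[of "x + 1"] F[of x] per\<phi>[of x]
    by (auto intro!: derivative_eq_intros simp: DERIV_shift)
  then have "F (x + 1) - F x = F (0 + 1) - F 0" for x
    by (intro DERIV_isconst_all) auto
  then have perF: "F (x + 1) = F x" for x using F01 by simp
  define c where "c = (LINT x|circle_measure. F x)"
  have "smooth_circle (\<lambda>x. F x - c)"
    using CF perF by (auto simp: smooth_circle_def C_k_circle_def periodic_fun_simple'_def
        intro: C_k_diff C_k_const)
  moreover have "deriv (\<lambda>x. F x - c) = \<phi>"
    by (intro ext DERIV_imp_deriv) (auto intro!: derivative_eq_intros F)
  moreover have "(LINT x|circle_measure. F x - c) = 0"
    using circle_integrable_continuous(1)[OF C_k_continuous[OF CF]]
    by (simp add: measure_circle c_def)
  ultimately show ?thesis by blast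
qed

lemma smooth_circle_iterated_antiderivative:
  assumes "smooth_circle \<phi>" "(LINT x|circle_measure. \<phi> x) = 0"
  shows "\<exists>\<psi>. smooth_circle \<psi> \<and> (deriv ^^ k) \<psi> = \<phi> \<and> (LINT x|circle_measure. \<psi> x) = 0"
proof (induction k)
  case 0
  show ?case using assms by auto
next
  case (Suc k)
  then obtain \<psi> where \<psi>: "smooth_circle \<psi>" "(deriv ^^ k) \<psi> = \<phi>" "(LINT x|circle_measure. \<psi> x) = 0"
    by blast
  obtain \<xi> where "smooth_circle \<xi>" "deriv \<xi> = \<psi>" "(LINT x|circle_measure. \<xi> x) = 0"
    using smooth_circle_antiderivative[OF \<psi>(1,3)] by blast
  then show ?case using \<psi> by (intro exI[of _ \<xi>]) (simp add: funpow_swap1)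
qed

section \<open>Density of trigonometric polynomials\<close>

lemma smooth_circle_cos_sin:
  "smooth_circle (\<lambda>x. cos (2 * pi * x))" "smooth_circle (\<lambda>x. sin (2 * pi * x))"
proof -
  have "C_k n (\<lambda>x. cos (2 * pi * x)) \<and> C_k n (\<lambda>x. sin (2 * pi * x))" for n
  proof (induction n)
    case 0
    show ?case by (auto simp: C_k_0 intro!: continuous_intros)
  next
    case (Suc n)
    have c: "((\<lambda>x. cos (2 * pi * x)) has_real_derivative (- (2 * pi) * sin (2 * pi * x))) (at x)" for x
      by (auto intro!: derivative_eq_intros)
    have s: "((\<lambda>x. sin (2 * pi * x)) has_real_derivative (2 * pi * cos (2 * pi * x))) (at x)" for x
      by (auto intro!: derivative_eq_intros)
    show ?case
      using Suc by (intro conjI C_k_SucI[OF c] C_k_SucI[OF s] C_k_mult C_k_const) auto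
  qed
  then show "smooth_circle (\<lambda>x. cos (2 * pi * x))" "smooth_circle (\<lambda>x. sin (2 * pi * x))"
    by (auto simp: smooth_circle_def C_k_circle_def periodic_fun_simple'_def distrib_left)
qed

text \<open>A real linear form on the plane, evaluated at \<open>cis\<close>, is a combination of
  cosine and sine; sums and products preserve test functions.\<close>

lemma smooth_circle_polynomial:
  assumes "real_polynomial_function p"
  shows "smooth_circle (\<lambda>x. p (cis (2 * pi * x)))"
  using assms
proof (induction p rule: real_polynomial_function.induct)
  case (linear h)
  interpret bounded_linear h by fact
  have "h (cis t) = cos t * h 1 + sin t * h \<i>" for t
  proof -
    have "cis t = cos t *\<^sub>R 1 + sin t *\<^sub>R \<i>"
      by (simp add: complex_eq_iff)
    then show ?thesis by (simp only: add scaleR real_scaleR_def)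
  qed
  then show ?case
    by (auto intro!: smooth_circle_add smooth_circle_mult smooth_circle_cos_sin smooth_circle_const)
qed (auto intro: smooth_circle_add smooth_circle_mult smooth_circle_const)

text \<open>\<open>h\<close> is carried to the unit circle by \<open>Arg2pi\<close> and approximated
  there by Stone-Weierstrass. Equal end values are what makes the transported function continuous
  across the cut.\<close>

lemma smooth_circle_uniform_approx:
  assumes h: "continuous_on {0..1} h" "h 0 = h 1" and "e > 0"
  shows "\<exists>\<phi>. smooth_circle \<phi> \<and> (\<forall>x\<in>{0..<1}. \<bar>h x - \<phi> x\<bar> < e)"
proof -
  define f where "f = h \<circ> (\<lambda>z. Arg2pi z / (2 * pi))"
  \<comment> \<open>The trivial homotopy serves to extract its consequence: a closed path induces a
    continuous map on the unit circle.\<close>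
  have "homotopic_loops UNIV h h"
    using h by (simp add: homotopic_loops_refl path_def pathstart_def pathfinish_def)
  then have "continuous_on (sphere 0 1) f"
    unfolding f_def
    using homotopic_with_imp_continuous[OF homotopic_loops_imp_homotopic_circlemaps] by blast
  then obtain p where p: "real_polynomial_function p" "\<And>z. z \<in> sphere 0 1 \<Longrightarrow> \<bar>f z - p z\<bar> < e"
    using Stone_Weierstrass_real_polynomial_function[of "sphere 0 1 :: complex set" f e] \<open>e > 0\<close>
    by auto
  have f_cis: "f (cis (2 * pi * x)) = h x" if "x \<in> {0..<1}" for x
  proof -
    have "Arg2pi (cis (2 * pi * x)) = 2 * pi * x"
      using that by (intro Arg2pi_unique[of 1]) (auto simp: cis_conv_exp)
    then show ?thesis by (simp add: f_def)
  qed
  have "\<forall>x\<in>{0..<1}. \<bar>h x - p (cis (2 * pi * x))\<bar> < e"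
  proof
    fix x :: real assume "x \<in> {0..<1}"
    then show "\<bar>h x - p (cis (2 * pi * x))\<bar> < e"
      using p(2)[of "cis (2 * pi * x)"] f_cis[of x] by simp
  qed
  then show ?thesis using smooth_circle_polynomial[OF p(1)] by blast
qed

lemma smooth_circle_square_integrable: "smooth_circle \<phi> \<Longrightarrow> square_integrable circle_measure \<phi>"
  using C_k_circle_square_integrable[of 0] by (simp add: smooth_circle_def)

text \<open>Replacing \<open>h\<close> by a test function within uniform distance e changes the
  integral by at most e times the L^1 norm of \<open>g\<close>.\<close>

lemma orthogonal_smooth_imp_orthogonal_continuous:
  assumes g: "square_integrable circle_measure g"
    and orth: "\<And>\<phi>. smooth_circle \<phi> \<Longrightarrow> (LINT x|circle_measure. g x * \<phi> x) = 0"
    and h: "continuous_on UNIV h" "h 0 = h 1"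
  shows "(LINT x|circle_measure. g x * h x) = 0"
proof -
  have "square_integrable circle_measure h"
    unfolding square_integrable_def using h continuous_on_subset
    by (auto intro!: circle_measurable_continuous circle_integrable_continuous(1) continuous_intros)
  have gi: "integrable circle_measure g"
    using g by (rule circle.square_integrable_integrable)
  have "\<bar>LINT x|circle_measure. g x * h x\<bar> \<le> e * (LINT x|circle_measure. \<bar>g x\<bar>)" if "e > 0" for e
  proof -
    obtain \<phi> where \<phi>: "smooth_circle \<phi>" "\<And>x. x \<in> {0..<1} \<Longrightarrow> \<bar>h x - \<phi> x\<bar> < e"
      using smooth_circle_uniform_approx[OF continuous_on_subset[OF h(1)] h(2) \<open>e > 0\<close>] by auto
    have i: "integrable circle_measure (\<lambda>x. g x * h x)" "integrable circle_measure (\<lambda>x. g x * \<phi> x)"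
      by (intro square_integrable_mult g \<open>square_integrable circle_measure h\<close>
          smooth_circle_square_integrable \<phi>)+
    have "(LINT x|circle_measure. g x * h x) = (LINT x|circle_measure. g x * h x - g x * \<phi> x)"
      using i orth[OF \<phi>(1)] by simp
    also have "\<bar>\<dots>\<bar> \<le> (LINT x|circle_measure. \<bar>g x * h x - g x * \<phi> x\<bar>)"
      by (rule integral_abs_bound)
    also have "\<dots> \<le> (LINT x|circle_measure. e * \<bar>g x\<bar>)"
    proof (rule integral_mono)
      fix x assume "x \<in> space circle_measure"
      then have "\<bar>g x\<bar> * \<bar>h x - \<phi> x\<bar> \<le> \<bar>g x\<bar> * e"
        using \<phi>(2)[of x] by (intro mult_left_mono) auto
      then show "\<bar>g x * h x - g x * \<phi> x\<bar> \<le> e * \<bar>g x\<bar>"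
        unfolding right_diff_distrib[symmetric] abs_mult by (simp add: mult.commute)
    qed (use i gi in auto)
    finally show ?thesis by simp
  qed
  moreover define G where "G = (LINT x|circle_measure. \<bar>g x\<bar>)"
  ultimately have *: "\<bar>LINT x|circle_measure. g x * h x\<bar> \<le> e * G" if "e > 0" for e
    using that by simp
  have "G \<ge> 0" unfolding G_def by simp
  have "\<bar>LINT x|circle_measure. g x * h x\<bar> \<le> 0 + e" if "e > 0" for e
  proof -
    \<comment> \<open>Dividing by \<open>G + 1\<close> covers the case \<open>G = 0\<close> as
      well.\<close>
    have "\<bar>LINT x|circle_measure. g x * h x\<bar> \<le> e / (G + 1) * G"
      using \<open>G \<ge> 0\<close> that by (intro *) auto
    also have "\<dots> \<le> e" using \<open>G \<ge> 0\<close> that by (simp add: field_simps)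
    finally show ?thesis by simp
  qed
  then have "\<bar>LINT x|circle_measure. g x * h x\<bar> \<le> 0"
    by (rule field_le_epsilon)
  then show ?thesis by simp
qed

text \<open>Continuous functions vanishing at the ends of \<open>[0, 1]\<close> converge boundedly to \<open>sgn g\<close>, and so
  orthogonality to them forces \<open>\<integral> \<bar>g\<bar> = 0\<close>.\<close>

theorem orthogonal_smooth_imp_AE_0:
  assumes g: "square_integrable circle_measure g"
    and orth: "\<And>\<phi>. smooth_circle \<phi> \<Longrightarrow> (LINT x|circle_measure. g x * \<phi> x) = 0"
  shows "AE x in circle_measure. g x = 0"
proof -
  have gi: "integrable circle_measure g"
    using g by (rule circle.square_integrable_integrable)
  then have [measurable]: "g \<in> borel_measurable circle_measure" by simp
  have "(\<lambda>x. sgn (g x)) measurable_on {0..<1}"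
    by (subst measurable_on_iff_borel_measurable) auto
  then obtain N k where N: "negligible N" and k: "\<And>n::nat. continuous_on UNIV (k n)"
    and lim: "\<And>x. x \<notin> N \<Longrightarrow> (\<lambda>n. k n x) \<longlonglongrightarrow> (if x \<in> {0..<1} then sgn (g x) else 0)"
    unfolding measurable_on_def by blast
  \<comment> \<open>The first factor clips to [-1, 1] and so provides domination. The second
    vanishes at 0 and 1, giving \<open>h n 0 = h n 1\<close>, and is eventually 1 at each interior
    point.\<close>
  define h where "h n x = max (-1) (min 1 (k n x)) * min 1 (real n * \<bar>x * (1 - x)\<bar>)" for n x
  have h_cont: "continuous_on UNIV (h n)" for n
    unfolding h_def by (intro continuous_intros k)
  have h_bound: "\<bar>h n x\<bar> \<le> 1" for n x
  proof -
    have "\<bar>max (-1) (min 1 (k n x))\<bar> * \<bar>min 1 (real n * \<bar>x * (1 - x)\<bar>)\<bar> \<le> 1 * 1"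
      by (intro mult_mono) auto
    then show ?thesis by (simp add: h_def abs_mult)
  qed
  have h_lim: "(\<lambda>n. h n x) \<longlonglongrightarrow> sgn (g x)" if "x \<in> {0<..<1}" "x \<notin> N" for x
  proof -
    have "(\<lambda>n. max (-1) (min 1 (k n x))) \<longlonglongrightarrow> max (-1) (min 1 (sgn (g x)))"
      using lim[OF that(2)] that(1) by (intro tendsto_intros) auto
    moreover have "max (-1) (min 1 (sgn (g x))) = sgn (g x)"
      by (auto simp: sgn_real_def)
    moreover have "(\<lambda>n. min 1 (real n * \<bar>x * (1 - x)\<bar>)) \<longlonglongrightarrow> 1"
    proof (rule tendsto_eventually)
      have pos: "\<bar>x * (1 - x)\<bar> > 0" using that(1) by simp
      obtain n0 :: nat where "1 / \<bar>x * (1 - x)\<bar> \<le> n0" using real_arch_simple by blast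
      then have n0: "1 \<le> n0 * \<bar>x * (1 - x)\<bar>" using pos by (simp add: field_simps)
      show "\<forall>\<^sub>F n in sequentially. min 1 (real n * \<bar>x * (1 - x)\<bar>) = 1"
      proof (rule eventually_sequentiallyI[of n0])
        fix n assume "n0 \<le> n"
        then have "n0 * \<bar>x * (1 - x)\<bar> \<le> n * \<bar>x * (1 - x)\<bar>"
          using pos by (intro mult_right_mono) auto
        then show "min 1 (real n * \<bar>x * (1 - x)\<bar>) = 1" using n0 by linarith
      qed
    qed
    ultimately show ?thesis
      unfolding h_def using tendsto_mult by fastforce
  qed
  \<comment> \<open>The point 0 joins the null set because the cutoff is 0 there for every
    n.\<close>
  have AE_N: "AE x in circle_measure. x \<notin> insert 0 N"
  proof -
    have "insert 0 N \<in> null_sets lebesgue"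
      using N by (simp flip: negligible_iff_null_sets)
    then have "AE x in lebesgue. x \<notin> insert 0 N"
      by (rule AE_not_in)
    then show ?thesis by (auto simp: AE_restrict_space_iff)
  qed
  have "(\<lambda>n. LINT x|circle_measure. g x * h n x) \<longlonglongrightarrow> (LINT x|circle_measure. g x * sgn (g x))"
  proof (rule integral_dominated_convergence[where w = "\<lambda>x. \<bar>g x\<bar>"])
    show "AE x in circle_measure. (\<lambda>n. g x * h n x) \<longlonglongrightarrow> g x * sgn (g x)"
      using AE_N AE_space by eventually_elim (auto intro!: tendsto_mult h_lim)
    show "AE x in circle_measure. norm (g x * h n x) \<le> \<bar>g x\<bar>" for n
      using mult_left_mono[OF h_bound[of n], of "\<bar>g _\<bar>"] by (auto simp: abs_mult)
    show "(\<lambda>x. g x * h n x) \<in> borel_measurable circle_measure" for n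
      using circle_measurable_continuous[OF h_cont] by measurable
  qed (use gi in auto)
  moreover have "(LINT x|circle_measure. g x * h n x) = 0" for n
    by (rule orthogonal_smooth_imp_orthogonal_continuous[OF g orth h_cont]) (auto simp: h_def)
  ultimately have "(LINT x|circle_measure. \<bar>g x\<bar>) = 0"
    using LIMSEQ_unique[OF tendsto_const[of 0]] by (simp add: abs_sgn[symmetric])
  then show ?thesis
    using integral_nonneg_eq_0_iff_AE[OF integrable_abs[OF gi]] by simp
qed

section \<open>Weak derivatives and mean-zero primitives\<close>

lemma smooth_circle_integral_derivs:
  assumes "smooth_circle \<phi>" "k \<ge> 1"
  shows "(LINT x|circle_measure. (deriv ^^ k) \<phi> x) = 0"
proof -
  obtain j where k: "k = Suc j" using assms(2) by (cases k) auto
  show ?thesis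
    unfolding k using smooth_circle_derivs[OF assms(1), of j] C_k_circle_integral_deriv
    by (auto simp: smooth_circle_def)
qed

lemma derivs_const_1: "k \<ge> 1 \<Longrightarrow> (deriv ^^ k) (\<lambda>x::real. 1) = (\<lambda>x. 0 :: real)"
proof (induction k)
  case (Suc k)
  then show ?case
    by (cases k) (auto simp: deriv_const)
qed simp

text \<open>The constant 1 is a test function on the circle, and its derivatives vanish.\<close>

lemma weak_deriv_mean_0:
  assumes "is_weak_deriv k f g" "k \<ge> 1"
  shows "(LINT x|circle_measure. g x) = 0"
proof -
  have "(LINT x|circle_measure. f x * 0) = (-1) ^ k * (LINT x|circle_measure. g x * 1)"
    using is_weak_derivD[OF assms(1) smooth_circle_const[of 1]] derivs_const_1[OF assms(2)] by simp
  then show ?thesis by simp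
qed

lemma L1_le_l2norm_circle:
  "square_integrable circle_measure f \<Longrightarrow> (LINT x|circle_measure. \<bar>f x\<bar>) \<le> l2norm circle_measure f"
  using circle.L1_le_l2norm[of f] by (simp add: measure_circle)

text \<open>After subtraction of its mean m, a test function is itself a k-th derivative of a test
  function. With c the mean of \<open>u\<close>, the integral of (u - c) \<phi> equals that of u
  (\<phi> - m), hence is 0. Periodicity leaves constants only, no polynomials of degree below
  k.\<close>

lemma weak_deriv_0_imp_AE_const:
  assumes u: "square_integrable circle_measure u"
    and weak: "\<And>\<phi>. smooth_circle \<phi> \<Longrightarrow> (LINT x|circle_measure. u x * (deriv ^^ k) \<phi> x) = 0"
  shows "AE x in circle_measure. u x = (LINT y|circle_measure. u y)"
proof -
  define c where "c = (LINT y|circle_measure. u y)"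
  have ui: "integrable circle_measure u" using u by (rule circle.square_integrable_integrable)
  have uc: "square_integrable circle_measure (\<lambda>x. u x - c)"
    by (intro square_integrable_diff u circle.square_integrable_const)
  have "AE x in circle_measure. u x - c = 0"
  proof (rule orthogonal_smooth_imp_AE_0[OF uc])
    fix \<phi> assume \<phi>: "smooth_circle \<phi>"
    note si = smooth_circle_square_integrable[OF \<phi>]
    define m where "m = (LINT y|circle_measure. \<phi> y)"
    have i: "integrable circle_measure \<phi>" "integrable circle_measure (\<lambda>x. u x * \<phi> x)"
      using si u by (auto intro: circle.square_integrable_integrable square_integrable_mult)
    have "smooth_circle (\<lambda>x. \<phi> x + (- m))"
      by (intro smooth_circle_add \<phi> smooth_circle_const)
    moreover have "(LINT x|circle_measure. \<phi> x + (- m)) = 0"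
      using i by (simp add: m_def measure_circle)
    ultimately obtain \<psi> where \<psi>: "smooth_circle \<psi>" "(deriv ^^ k) \<psi> = (\<lambda>x. \<phi> x - m)"
      using smooth_circle_iterated_antiderivative[of "\<lambda>x. \<phi> x + (- m)" k] by auto
    have "0 = (LINT x|circle_measure. u x * \<phi> x - m * u x)"
      using weak[OF \<psi>(1)] \<psi>(2) by (simp add: algebra_simps)
    also have "\<dots> = (LINT x|circle_measure. u x * \<phi> x) - m * c"
      using i ui by (simp add: c_def)
    also have "\<dots> = (LINT x|circle_measure. u x * \<phi> x - c * \<phi> x)"
      using i by (simp add: m_def)
    finally show "(LINT x|circle_measure. (u x - c) * \<phi> x) = 0"
      by (simp add: algebra_simps)
  qed
  then show ?thesis by (simp add: c_def)
qed

lemma is_weak_deriv_unique: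
  assumes "square_integrable circle_measure g" "square_integrable circle_measure h"
    and "is_weak_deriv k f g" "is_weak_deriv k f h"
  shows "AE x in circle_measure. g x = h x"
proof -
  have "AE x in circle_measure. g x - h x = 0"
  proof (rule orthogonal_smooth_imp_AE_0)
    show "square_integrable circle_measure (\<lambda>x. g x - h x)"
      by (intro square_integrable_diff assms)
    fix \<phi> assume \<phi>: "smooth_circle \<phi>"
    note si = smooth_circle_square_integrable[OF \<phi>]
    have "(-1) ^ k * (LINT x|circle_measure. g x * \<phi> x) = (-1) ^ k * (LINT x|circle_measure. h x * \<phi> x)"
      using is_weak_derivD[OF assms(3) \<phi>] is_weak_derivD[OF assms(4) \<phi>] by simp
    then show "(LINT x|circle_measure. (g x - h x) * \<phi> x) = 0"
      using square_integrable_mult[OF assms(1) si] square_integrable_mult[OF assms(2) si]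
      by (simp add: left_diff_distrib)
  qed
  then show ?thesis by simp
qed

text \<open>The integral of \<open>v\<close> from 0 to \<open>frac x\<close>. The cutoff sits inside
  the integrand, so measurability and Fubini apply to a function on the product; \<open>frac\<close>
  makes the result periodic even when \<open>v\<close> has nonzero mean, at the price of a
  jump.\<close>

definition circle_primitive :: "(real \<Rightarrow> real) \<Rightarrow> real \<Rightarrow> real" where
  "circle_primitive v x = (LINT y|circle_measure. (if y < frac x then v y else 0))"

text \<open>The normalisation makes the operator iterable: the output meets the zero-mean condition
  under which the next primitive has the right weak derivative.\<close>

definition mean_zero_primitive :: "(real \<Rightarrow> real) \<Rightarrow> real \<Rightarrow> real" where
  "mean_zero_primitive v x = circle_primitive v x - (LINT z|circle_measure. circle_primitive v z)"

lemma ident_circle_measurable [measurable]: "(\<lambda>x. x) \<in> circle_measure \<rightarrow>\<^sub>M borel"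
  by (rule circle_measurable_continuous) simp

lemma circle_primitive_bound:
  assumes "square_integrable circle_measure v"
  shows "\<bar>circle_primitive v x\<bar> \<le> l2norm circle_measure v"
proof -
  have vi: "integrable circle_measure v"
    using assms by (rule circle.square_integrable_integrable)
  then have [measurable]: "v \<in> borel_measurable circle_measure" by simp
  have "\<bar>circle_primitive v x\<bar> \<le> (LINT y|circle_measure. \<bar>if y < frac x then v y else 0\<bar>)"
    unfolding circle_primitive_def by (rule integral_abs_bound)
  also have "\<dots> \<le> (LINT y|circle_measure. \<bar>v y\<bar>)"
    by (intro integral_mono Bochner_Integration.integrable_bound[OF vi]) (use vi in auto)
  also have "\<dots> \<le> l2norm circle_measure v" by (rule L1_le_l2norm_circle[OF assms])
  finally show ?thesis .
qed

lemma circle_primitive_square_integrable: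
  assumes "square_integrable circle_measure v"
  shows "square_integrable circle_measure (circle_primitive v)"
proof (rule circle.square_integrable_bounded[OF _ circle_primitive_bound[OF assms]])
  have [measurable]: "v \<in> borel_measurable circle_measure"
    using assms by (simp add: square_integrable_def)
  have "(\<lambda>x. LINT y|circle_measure. (if y < x then v y else 0)) \<in> borel_measurable circle_measure"
    by measurable
  also have "?this \<longleftrightarrow> circle_primitive v \<in> borel_measurable circle_measure"
    by (rule measurable_cong) (simp add: circle_primitive_def frac_eq)
  finally show "circle_primitive v \<in> borel_measurable circle_measure" .
qed

lemma l2norm_circle_bounded:
  assumes "f \<in> borel_measurable circle_measure" "\<And>x. \<bar>f x\<bar> \<le> B"
  shows "l2norm circle_measure f \<le> B"
proof -
  have "B \<ge> 0" using assms(2)[of 0] by simp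
  have "(LINT x|circle_measure. (f x)\<^sup>2) \<le> (LINT x|circle_measure. B\<^sup>2)"
  proof (rule integral_mono)
    show "integrable circle_measure (\<lambda>x. (f x)\<^sup>2)"
      using circle.square_integrable_bounded[OF assms] by (simp add: square_integrable_def)
    show "(f x)\<^sup>2 \<le> B\<^sup>2" for x
      using power_mono[OF assms(2), of x 2] by simp
  qed simp
  then show ?thesis
    using \<open>B \<ge> 0\<close> by (simp add: l2norm_def measure_circle real_le_lsqrt)
qed

text \<open>The factor 2 pays once for the primitive and once for its mean, each bounded by the L^1
  norm of \<open>v\<close>.\<close>

lemma mean_zero_primitive:
  assumes v: "square_integrable circle_measure v"
  shows "periodic_fun_simple' (mean_zero_primitive v)"
    and "square_integrable circle_measure (mean_zero_primitive v)"
    and "(LINT x|circle_measure. mean_zero_primitive v x) = 0"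
    and "l2norm circle_measure (mean_zero_primitive v) \<le> 2 * l2norm circle_measure v"
proof -
  note P = circle_primitive_square_integrable[OF v]
  note Pi = circle.square_integrable_integrable[OF P]
  show "periodic_fun_simple' (mean_zero_primitive v)"
    by (rule periodicI_frac) (simp add: mean_zero_primitive_def circle_primitive_def)
  show si: "square_integrable circle_measure (mean_zero_primitive v)"
    unfolding mean_zero_primitive_def by (intro square_integrable_diff P circle.square_integrable_const)
  show "(LINT x|circle_measure. mean_zero_primitive v x) = 0"
    unfolding mean_zero_primitive_def using Pi by (simp add: measure_circle)
  have "\<bar>mean_zero_primitive v x\<bar> \<le> 2 * l2norm circle_measure v" for x
  proof -
    have "\<bar>LINT z|circle_measure. circle_primitive v z\<bar> \<le> (LINT z|circle_measure. \<bar>circle_primitive v z\<bar>)"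
      by (rule integral_abs_bound)
    also have "\<dots> \<le> (LINT z|circle_measure. l2norm circle_measure v)"
      by (intro integral_mono circle_primitive_bound v) (use Pi in auto)
    finally show ?thesis
      using circle_primitive_bound[OF v, of x]
      by (simp add: mean_zero_primitive_def measure_circle abs_le_iff)
  qed
  then show "l2norm circle_measure (mean_zero_primitive v) \<le> 2 * l2norm circle_measure v"
    using si by (intro l2norm_circle_bounded square_integrable_measurable)
qed

text \<open>Fubini over the triangle y < x replaces the absolute continuity of the primitive. The
  inner integral is \<phi>(1) - \<phi>(y); the term with \<phi>(1) dies by the zero mean of
  \<open>v\<close>, and the subtracted constant dies because a derivative of \<phi> has integral
  0.\<close>

lemma is_weak_deriv_mean_zero_primitive:
  assumes v: "square_integrable circle_measure v" and mean: "(LINT x|circle_measure. v x) = 0"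
  shows "is_weak_deriv 1 (mean_zero_primitive v) v"
proof (rule is_weak_derivI)
  fix \<phi> assume \<phi>: "smooth_circle \<phi>"
  let ?P = "circle_primitive v" and ?D = "deriv \<phi>"
  note P = circle_primitive_square_integrable[OF v]
  note vi = circle.square_integrable_integrable[OF v]
  have [measurable]: "v \<in> borel_measurable circle_measure"
    using v by (simp add: square_integrable_def)
  have D: "smooth_circle ?D" by (rule smooth_circle_deriv[OF \<phi>])
  have D_cont: "continuous_on A ?D" for A
    using D C_k_continuous by (auto simp: smooth_circle_def C_k_circle_def)
  have [measurable]: "?D \<in> borel_measurable circle_measure"
    by (rule circle_measurable_continuous[OF D_cont])
  have "bounded (?D ` {0..1})"
    by (intro compact_imp_bounded compact_continuous_image D_cont) auto
  then obtain B where B: "\<And>x. x \<in> {0..1} \<Longrightarrow> \<bar>?D x\<bar> \<le> B"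
    unfolding bounded_iff by (metis image_eqI real_norm_def)
  have "B \<ge> 0" using B[of 0] by simp
  \<comment> \<open>The integrand on the triangle: integrating over \<open>y\<close> gives the
    primitive times the derivative of \<open>\<phi>\<close>, integrating over \<open>x\<close> gives
    \<open>v y * (\<phi> 1 - \<phi> y)\<close>.\<close>
  define f where "f x y = (if y < x then v y * ?D x else 0)" for x y
  interpret pair_sigma_finite circle_measure circle_measure ..
  have fm [measurable]: "case_prod f \<in> borel_measurable (circle_measure \<Otimes>\<^sub>M circle_measure)"
    unfolding f_def case_prod_beta by measurable
  have fb: "\<bar>f x y\<bar> \<le> B * \<bar>v y\<bar>" if "x \<in> {0..<1}" for x y
    using B[of x] that \<open>B \<ge> 0\<close> mult_right_mono[of "\<bar>?D x\<bar>" B "\<bar>v y\<bar>"]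
    by (auto simp: f_def abs_mult mult.commute)
  have fi: "integrable circle_measure (f x)" if "x \<in> {0..<1}" for x
    by (rule Bochner_Integration.integrable_bound[of _ "\<lambda>y. B * \<bar>v y\<bar>"])
      (use vi fb[OF that] \<open>B \<ge> 0\<close> that in \<open>auto simp: f_def abs_mult\<close>)
  have "integrable (circle_measure \<Otimes>\<^sub>M circle_measure) (case_prod f)"
  proof (rule Fubini_integrable[OF fm])
    show "AE x in circle_measure. integrable circle_measure (\<lambda>y. case (x, y) of (x, y) \<Rightarrow> f x y)"
      using AE_space by eventually_elim (use fi in auto)
    show "integrable circle_measure (\<lambda>x. LINT y|circle_measure. norm (case (x, y) of (x, y) \<Rightarrow> f x y))"
    proof (rule circle.integrable_const_bound[of _ "LINT y|circle_measure. B * \<bar>v y\<bar>"])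
      show "AE x in circle_measure. norm (LINT y|circle_measure. norm (case (x, y) of (x, y) \<Rightarrow> f x y))
          \<le> (LINT y|circle_measure. B * \<bar>v y\<bar>)"
        using AE_space
      proof eventually_elim
        case (elim x)
        then have x: "x \<in> {0..<1}" by simp
        have "(LINT y|circle_measure. \<bar>f x y\<bar>) \<le> (LINT y|circle_measure. B * \<bar>v y\<bar>)"
          by (intro integral_mono integrable_abs fi[OF x] integrable_mult_right vi fb[OF x])
        then show ?case by simp
      qed
    qed measurable
  qed
  then have fub: "(LINT y|circle_measure. LINT x|circle_measure. f x y) =
      (LINT x|circle_measure. LINT y|circle_measure. f x y)"
    by (rule Fubini_integral)
  have inner1: "(LINT y|circle_measure. f x y) = ?P x * ?D x" if "x \<in> {0..<1}" for x
  proof -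
    have "f x = (\<lambda>y. ?D x * (if y < x then v y else 0))" by (auto simp: f_def)
    then have "(LINT y|circle_measure. f x y) = ?D x * (LINT y|circle_measure. (if y < x then v y else 0))"
      by simp
    moreover have "frac x = x" using that by (simp add: frac_eq)
    ultimately show ?thesis by (simp add: circle_primitive_def)
  qed
  have inner2: "(LINT x|circle_measure. f x y) = v y * (\<phi> 1 - \<phi> y)" if "y \<in> {0..<1}" for y
  proof -
    have sets: "{y<..} \<inter> {0..<1} = {y<..<1}" using that by auto
    have "(LINT x|circle_measure. (if x \<in> {y<..} then ?D x else 0)) = (LINT x|lebesgue_on {y<..<1}. ?D x)"
      using Lebesgue_Measure.integral_restrict_Int[of "{y<..}" "{0..<1}" ?D] by (simp add: sets)
    also have "\<dots> = integral {y<..<1} ?D"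
    proof (rule lebesgue_integral_eq_integral)
      have "?D absolutely_integrable_on {y..1}"
        by (rule absolutely_integrable_continuous_real[OF D_cont])
      then have "?D absolutely_integrable_on {y<..<1}"
        by (rule set_integrable_subset) auto
      then show "integrable (lebesgue_on {y<..<1}) ?D"
        by (simp add: integrable_restrict_space set_integrable_def)
    qed simp
    also have "\<dots> = integral {y..1} ?D"
      by (rule integral_open_interval_real[symmetric])
    also have "\<dots> = \<phi> 1 - \<phi> y"
    proof (rule integral_unique, rule fundamental_theorem_of_calculus)
      show "y \<le> 1" using that by simp
      show "(\<phi> has_vector_derivative ?D x) (at x within {y..1})" for x
        using smooth_circle_DERIV[OF \<phi>, of x]
        by (auto simp: has_real_derivative_iff_has_vector_derivative[symmetric] intro: DERIV_subset)
    qed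
    finally have "(LINT x|circle_measure. (if y < x then ?D x else 0)) = \<phi> 1 - \<phi> y" by simp
    moreover have "(\<lambda>x. f x y) = (\<lambda>x. v y * (if y < x then ?D x else 0))" by (auto simp: f_def)
    ultimately show ?thesis by simp
  qed
  have "(LINT x|circle_measure. ?P x * ?D x) = (LINT x|circle_measure. LINT y|circle_measure. f x y)"
    by (rule Bochner_Integration.integral_cong) (auto simp: inner1)
  also have "\<dots> = (LINT y|circle_measure. v y * (\<phi> 1 - \<phi> y))"
    unfolding fub[symmetric] by (rule Bochner_Integration.integral_cong) (auto simp: inner2)
  also have "\<dots> = (LINT y|circle_measure. \<phi> 1 * v y - v y * \<phi> y)"
    by (simp add: algebra_simps)
  also have "\<dots> = - (LINT y|circle_measure. v y * \<phi> y)"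
    using vi square_integrable_mult[OF v smooth_circle_square_integrable[OF \<phi>]] by (simp add: mean)
  finally have PD: "(LINT x|circle_measure. ?P x * ?D x) = - (LINT y|circle_measure. v y * \<phi> y)" .
  define c where "c = (LINT z|circle_measure. ?P z)"
  have "(LINT x|circle_measure. mean_zero_primitive v x * ?D x) =
      (LINT x|circle_measure. ?P x * ?D x - c * ?D x)"
    by (simp add: mean_zero_primitive_def c_def algebra_simps)
  also have "\<dots> = (LINT x|circle_measure. ?P x * ?D x) - c * (LINT x|circle_measure. ?D x)"
    using square_integrable_mult[OF P smooth_circle_square_integrable[OF D]]
      circle.square_integrable_integrable[OF smooth_circle_square_integrable[OF D]]
    by simp
  also have "(LINT x|circle_measure. ?D x) = 0"
    using smooth_circle_integral_derivs[OF \<phi>, of 1] by simp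
  finally show "(LINT x|circle_measure. mean_zero_primitive v x * (deriv ^^ 1) \<phi> x) =
      (-1) ^ 1 * (LINT x|circle_measure. v x * \<phi> x)"
    by (simp add: PD)
qed

lemma mean_zero_primitive_iter:
  assumes "square_integrable circle_measure v" "(LINT x|circle_measure. v x) = 0"
  shows "square_integrable circle_measure ((mean_zero_primitive ^^ k) v)"
    and "(LINT x|circle_measure. (mean_zero_primitive ^^ k) v x) = 0"
    and "l2norm circle_measure ((mean_zero_primitive ^^ k) v) \<le> 2 ^ k * l2norm circle_measure v"
    and "is_weak_deriv k ((mean_zero_primitive ^^ k) v) v"
proof -
  show si: "square_integrable circle_measure ((mean_zero_primitive ^^ k) v)" for k
    by (induction k) (auto intro: assms mean_zero_primitive)
  show m: "(LINT x|circle_measure. (mean_zero_primitive ^^ k) v x) = 0" for k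
    using mean_zero_primitive(3)[OF si] assms(2) by (cases k) auto
  show "l2norm circle_measure ((mean_zero_primitive ^^ k) v) \<le> 2 ^ k * l2norm circle_measure v"
  proof (induction k)
    case (Suc k)
    show ?case using mean_zero_primitive(4)[OF si[of k]] Suc by simp
  qed simp
  show "is_weak_deriv k ((mean_zero_primitive ^^ k) v) v"
  proof (induction k)
    case 0
    show ?case by (rule is_weak_derivI) simp
  next
    case (Suc k)
    show ?case
    proof (rule is_weak_derivI)
      fix \<phi> assume \<phi>: "smooth_circle \<phi>"
      show "(LINT x|circle_measure. (mean_zero_primitive ^^ Suc k) v x * (deriv ^^ Suc k) \<phi> x) =
          (-1) ^ Suc k * (LINT x|circle_measure. v x * \<phi> x)"
        using is_weak_derivD[OF is_weak_deriv_mean_zero_primitive[OF si m] smooth_circle_derivs[OF \<phi>], of k k]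
          is_weak_derivD[OF Suc \<phi>]
        by simp
    qed
  qed
qed

text \<open>\<open>f\<close> and the k-fold primitive of \<open>g\<close> share their k-th weak
  derivative, so they differ by a constant, which is invisible to derivatives of order j >= 1.
  Stripping j of the k primitives leaves k - j.\<close>

lemma is_weak_deriv_lower_order:
  assumes f: "square_integrable circle_measure f" and g: "square_integrable circle_measure g"
    and w: "is_weak_deriv k f g" and j: "1 \<le> j" "j \<le> k"
  shows "is_weak_deriv j f ((mean_zero_primitive ^^ (k - j)) g)"
proof -
  let ?J = "\<lambda>i. (mean_zero_primitive ^^ i) g"
  have m: "(LINT x|circle_measure. g x) = 0"
    using weak_deriv_mean_0[OF w] j by simp
  note J = mean_zero_primitive_iter[OF g m]
  define u where "u x = f x - ?J k x" for x
  have u: "square_integrable circle_measure u"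
    unfolding u_def by (intro square_integrable_diff f J)
  have "(LINT x|circle_measure. u x * (deriv ^^ k) \<phi> x) = 0" if \<phi>: "smooth_circle \<phi>" for \<phi>
  proof -
    note si = smooth_circle_square_integrable[OF smooth_circle_derivs[OF \<phi>, of k]]
    show ?thesis
      using square_integrable_mult[OF f si] square_integrable_mult[OF J(1)[of k] si]
        is_weak_derivD[OF w \<phi>] is_weak_derivD[OF J(4) \<phi>]
      by (simp add: u_def left_diff_distrib)
  qed
  then have c: "AE x in circle_measure. u x = (LINT y|circle_measure. u y)"
    by (rule weak_deriv_0_imp_AE_const[OF u])
  define c where "c = (LINT y|circle_measure. u y)"
  show ?thesis
  proof (rule is_weak_derivI)
    fix \<phi> assume \<phi>: "smooth_circle \<phi>"
    let ?D = "(deriv ^^ j) \<phi>"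
    note si = smooth_circle_square_integrable[OF smooth_circle_derivs[OF \<phi>, of j]]
    have "(LINT x|circle_measure. f x * ?D x) = (LINT x|circle_measure. ?J k x * ?D x + c * ?D x)"
    proof (rule integral_cong_AE)
      show "AE x in circle_measure. f x * ?D x = ?J k x * ?D x + c * ?D x"
        using c by eventually_elim (simp add: u_def c_def algebra_simps)
    qed (use f si J(1)[of k] in \<open>auto simp: square_integrable_def\<close>)
    also have "\<dots> = (LINT x|circle_measure. ?J k x * ?D x) + c * (LINT x|circle_measure. ?D x)"
      using square_integrable_mult[OF J(1)[of k] si] circle.square_integrable_integrable[OF si] by simp
    also have "(LINT x|circle_measure. ?D x) = 0"
      using smooth_circle_integral_derivs[OF \<phi> j(1)] .
    also have "?J k = (mean_zero_primitive ^^ j) (?J (k - j))"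
      using j(2) by (metis funpow_add le_add_diff_inverse o_apply)
    also have "(LINT x|circle_measure. (mean_zero_primitive ^^ j) (?J (k - j)) x * ?D x) =
        (-1) ^ j * (LINT x|circle_measure. ?J (k - j) x * \<phi> x)"
      by (rule is_weak_derivD[OF mean_zero_primitive_iter(4)[OF J(1,2)] \<phi>])
    finally show "(LINT x|circle_measure. f x * ?D x) = (-1) ^ j * (LINT x|circle_measure. ?J (k - j) x * \<phi> x)"
      by simp
  qed
qed

section \<open>Sobolev functions and their chosen weak derivatives\<close>

lemma L2_circle_iff: "L2_circle f \<longleftrightarrow> periodic_fun_simple' f \<and> square_integrable circle_measure f"
  by (simp add: L2_circle_def square_integrable_def)

lemma norm_L2_eq: "norm_L2 = l2norm circle_measure"
  by (simp add: norm_L2_def l2norm_def fun_eq_iff)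

lemma L2_circle_lincomb:
  assumes "L2_circle f" "L2_circle g"
  shows "L2_circle (\<lambda>x. s * f x + t * g x)"
  using assms unfolding L2_circle_iff
  by (auto simp: periodic_fun_simple'_def intro: square_integrable_add square_integrable_scale)

text \<open>The top derivative alone suffices, since iterated primitives of it supply all lower
  ones. This spares separate limits for the intermediate orders.\<close>

lemma sobolev_HI:
  assumes f: "L2_circle f" and g: "L2_circle g" and w: "is_weak_deriv k f g"
  shows "sobolev_H k f"
  unfolding sobolev_H_def
proof (intro conjI ballI f)
  fix j assume j: "j \<in> {1..k}"
  note si = f[unfolded L2_circle_iff, THEN conjunct2] g[unfolded L2_circle_iff, THEN conjunct2]
  have m: "(LINT x|circle_measure. g x) = 0"
    using weak_deriv_mean_0[OF w] j by simp
  note J = mean_zero_primitive_iter[OF si(2) m, of "k - j"]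
  have "periodic_fun_simple' ((mean_zero_primitive ^^ (k - j)) g)"
  proof (cases "k - j")
    case 0
    then show ?thesis using g by (simp add: L2_circle_iff)
  next
    case (Suc i)
    then show ?thesis
      using mean_zero_primitive(1)[OF mean_zero_primitive_iter(1)[OF si(2) m, of i]] by simp
  qed
  then have "L2_circle ((mean_zero_primitive ^^ (k - j)) g)"
    using J(1) by (simp add: L2_circle_iff)
  moreover have "is_weak_deriv j f ((mean_zero_primitive ^^ (k - j)) g)"
    using j by (intro is_weak_deriv_lower_order[OF si w]) auto
  ultimately show "\<exists>h. L2_circle h \<and> is_weak_deriv j f h" by blast
qed

lemma weak_deriv_works:
  assumes "sobolev_H k f" "1 \<le> j" "j \<le> k"
  shows "L2_circle (weak_deriv j f)" "is_weak_deriv j f (weak_deriv j f)"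
proof -
  have "\<exists>g. L2_circle g \<and> is_weak_deriv j f g"
    using assms by (auto simp: sobolev_H_def)
  from someI_ex[OF this] show "L2_circle (weak_deriv j f)" "is_weak_deriv j f (weak_deriv j f)"
    unfolding weak_deriv_def by auto
qed

text \<open>Together with \<open>weak_deriv_works\<close> this is the only access to the choice
  behind \<open>weak_deriv\<close>; it pins the choice down up to a null set.\<close>

lemma weak_deriv_AE_eq:
  assumes "L2_circle g" "is_weak_deriv j f g"
  shows "AE x in circle_measure. weak_deriv j f x = g x"
proof -
  have "\<exists>g. L2_circle g \<and> is_weak_deriv j f g" using assms by blast
  from someI_ex[OF this] have "L2_circle (weak_deriv j f) \<and> is_weak_deriv j f (weak_deriv j f)"
    unfolding weak_deriv_def .
  then show ?thesis
    using assms by (intro is_weak_deriv_unique[of _ _ j f]) (simp_all add: L2_circle_iff)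
qed

lemma is_weak_deriv_lincomb:
  assumes "square_integrable circle_measure f" "square_integrable circle_measure f'"
    "square_integrable circle_measure g" "square_integrable circle_measure g'"
    and "is_weak_deriv k f g" "is_weak_deriv k f' g'"
  shows "is_weak_deriv k (\<lambda>x. s * f x + t * f' x) (\<lambda>x. s * g x + t * g' x)"
proof (rule is_weak_derivI)
  fix \<phi> assume \<phi>: "smooth_circle \<phi>"
  note si = smooth_circle_square_integrable[OF \<phi>]
    smooth_circle_square_integrable[OF smooth_circle_derivs[OF \<phi>, of k]]
  have "(LINT x|circle_measure. (s * f x + t * f' x) * (deriv ^^ k) \<phi> x) =
      s * (LINT x|circle_measure. f x * (deriv ^^ k) \<phi> x) + t * (LINT x|circle_measure. f' x * (deriv ^^ k) \<phi> x)"
    using square_integrable_mult[OF assms(1) si(2)] square_integrable_mult[OF assms(2) si(2)]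
    by (simp add: distrib_right mult.assoc)
  also have "\<dots> = (-1) ^ k * (s * (LINT x|circle_measure. g x * \<phi> x) + t * (LINT x|circle_measure. g' x * \<phi> x))"
    by (simp add: is_weak_derivD[OF assms(5) \<phi>] is_weak_derivD[OF assms(6) \<phi>] algebra_simps)
  also have "\<dots> = (-1) ^ k * (LINT x|circle_measure. (s * g x + t * g' x) * \<phi> x)"
    using square_integrable_mult[OF assms(3) si(1)] square_integrable_mult[OF assms(4) si(1)]
    by (simp add: distrib_right mult.assoc)
  finally show "(LINT x|circle_measure. (s * f x + t * f' x) * (deriv ^^ k) \<phi> x) =
      (-1) ^ k * (LINT x|circle_measure. (s * g x + t * g' x) * \<phi> x)" .
qed

lemma sobolev_H_lincomb:
  assumes f: "sobolev_H k f" and g: "sobolev_H k g"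
  shows "sobolev_H k (\<lambda>x. s * f x + t * g x)"
    and "1 \<le> j \<Longrightarrow> j \<le> k \<Longrightarrow>
      AE x in circle_measure. weak_deriv j (\<lambda>x. s * f x + t * g x) x = s * weak_deriv j f x + t * weak_deriv j g x"
proof -
  have L: "L2_circle f" "L2_circle g" using assms by (auto simp: sobolev_H_def)
  have *: "L2_circle (\<lambda>x. s * weak_deriv j f x + t * weak_deriv j g x)"
    "is_weak_deriv j (\<lambda>x. s * f x + t * g x) (\<lambda>x. s * weak_deriv j f x + t * weak_deriv j g x)"
    if "1 \<le> j" "j \<le> k" for j
  proof -
    note F = weak_deriv_works[OF f that] and G = weak_deriv_works[OF g that]
    show "L2_circle (\<lambda>x. s * weak_deriv j f x + t * weak_deriv j g x)"
      by (rule L2_circle_lincomb[OF F(1) G(1)])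
    show "is_weak_deriv j (\<lambda>x. s * f x + t * g x) (\<lambda>x. s * weak_deriv j f x + t * weak_deriv j g x)"
      using L F G by (intro is_weak_deriv_lincomb) (auto simp: L2_circle_iff)
  qed
  show "sobolev_H k (\<lambda>x. s * f x + t * g x)"
    unfolding sobolev_H_def
  proof (intro conjI ballI L2_circle_lincomb[OF L])
    fix j assume "j \<in> {1..k}"
    then show "\<exists>h. L2_circle h \<and> is_weak_deriv j (\<lambda>x. s * f x + t * g x) h"
      by (intro exI[of _ "\<lambda>x. s * weak_deriv j f x + t * weak_deriv j g x"] conjI *) auto
  qed
  show "AE x in circle_measure. weak_deriv j (\<lambda>x. s * f x + t * g x) x = s * weak_deriv j f x + t * weak_deriv j g x"
    if "1 \<le> j" "j \<le> k"
    by (rule weak_deriv_AE_eq[OF *[OF that]])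
qed

text \<open>A Poincare inequality: the lower derivative is a (k - j)-fold mean-zero primitive of the
  top one, and each primitive costs a factor 2. It controls orders whose weight may be 0.\<close>

lemma norm_weak_deriv_le:
  assumes "sobolev_H k f" "1 \<le> j" "j \<le> k"
  shows "norm_L2 (weak_deriv j f) \<le> 2 ^ (k - j) * norm_L2 (weak_deriv k f)"
proof -
  let ?g = "weak_deriv k f"
  have si: "square_integrable circle_measure f" "square_integrable circle_measure ?g"
    and w: "is_weak_deriv k f ?g"
    and sj: "square_integrable circle_measure (weak_deriv j f)" "is_weak_deriv j f (weak_deriv j f)"
    using assms weak_deriv_works[OF assms(1)] by (auto simp: sobolev_H_def L2_circle_iff)
  have m: "(LINT x|circle_measure. ?g x) = 0"
    using weak_deriv_mean_0[OF w] assms by simp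
  note J = mean_zero_primitive_iter[OF si(2) m, of "k - j"]
  have "AE x in circle_measure. weak_deriv j f x = (mean_zero_primitive ^^ (k - j)) ?g x"
    by (rule is_weak_deriv_unique[OF sj(1) J(1) sj(2) is_weak_deriv_lower_order[OF si w assms(2,3)]])
  then have "norm_L2 (weak_deriv j f) = norm_L2 ((mean_zero_primitive ^^ (k - j)) ?g)"
    unfolding norm_L2_eq using J(1) sj(1) by (intro l2norm_cong_AE) (auto simp: square_integrable_def)
  then show ?thesis using J(3) by (simp add: norm_L2_eq)
qed

section \<open>Minimizing weighted Sobolev norms\<close>

lemma member_le_sum_atMost:
  fixes f :: "nat \<Rightarrow> real"
  assumes "\<And>j. j \<le> k \<Longrightarrow> f j \<ge> 0" "i \<le> k"
  shows "f i \<le> (\<Sum>j\<le>k. f j)"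
  using assms by (intro member_le_sum) auto

text \<open>Uniform convexity of L^2. With x, y, z the norms of \<open>u i\<close>,
  \<open>u l\<close> and their midpoint, the squared distance is (x - y)^2 + (x + y - 2z)(x + y +
  2z): convergence of the norms controls the first term, the midpoint defect the second.\<close>

lemma l2norm_midpoint_Cauchy:
  assumes u: "\<And>i::nat. square_integrable M (u i)"
    and conv: "convergent (\<lambda>i. l2norm M (u i))"
    and mid: "\<And>e. e > 0 \<Longrightarrow> \<exists>N. \<forall>i\<ge>N. \<forall>l\<ge>N.
      l2norm M (u i) + l2norm M (u l) - 2 * l2norm M (\<lambda>x. (u i x + u l x) / 2) \<le> e"
    and "e > 0"
  shows "\<exists>N. \<forall>i\<ge>N. \<forall>l\<ge>N. l2norm M (\<lambda>x. u i x - u l x) < e"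
proof -
  have "Bseq (\<lambda>i. l2norm M (u i))" using conv by (rule convergent_imp_Bseq)
  then obtain B where B: "B > 0" "\<And>i. l2norm M (u i) \<le> B"
    by (auto simp: Bseq_def)
  obtain N1 where N1: "\<And>i l. i \<ge> N1 \<Longrightarrow> l \<ge> N1 \<Longrightarrow> \<bar>l2norm M (u i) - l2norm M (u l)\<bar> < e / 2"
    using convergent_Cauchy[OF conv] half_gt_zero[OF \<open>e > 0\<close>] unfolding Cauchy_def dist_real_def by blast
  \<comment> \<open>As x + y + 2z is at most 4B, this makes the second term at most e^2/2; with
    (e/2)^2 from the first the total is 3/4 e^2.\<close>
  define \<delta> where "\<delta> = e\<^sup>2 / (8 * B)"
  have "\<delta> > 0" using \<open>e > 0\<close> B(1) by (simp add: \<delta>_def)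
  then obtain N2 where N2: "\<And>i l. i \<ge> N2 \<Longrightarrow> l \<ge> N2 \<Longrightarrow>
      l2norm M (u i) + l2norm M (u l) - 2 * l2norm M (\<lambda>x. (u i x + u l x) / 2) \<le> \<delta>"
    using mid by meson
  have "l2norm M (\<lambda>x. u i x - u l x) < e" if "i \<ge> max N1 N2" "l \<ge> max N1 N2" for i l
  proof -
    define x y z where "x = l2norm M (u i)" and "y = l2norm M (u l)"
      and "z = l2norm M (\<lambda>x. (u i x + u l x) / 2)"
    have z: "2 * z \<le> x + y"
      using l2norm_triangle[OF u u, of i l] l2norm_scale[of M "1/2" "\<lambda>x. u i x + u l x"]
      by (simp add: x_def y_def z_def)
    have "(x - y)\<^sup>2 \<le> (e / 2)\<^sup>2"
      using N1[of i l] that \<open>e > 0\<close> by (subst abs_le_square_iff[symmetric]) (simp add: x_def y_def)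
    moreover have "(x + y - 2 * z) * (x + y + 2 * z) \<le> \<delta> * (4 * B)"
      using N2[of i l] that B(2)[of i] B(2)[of l] z \<open>\<delta> > 0\<close>
      by (intro mult_mono) (auto simp: x_def y_def z_def)
    moreover have "\<delta> * (4 * B) = e\<^sup>2 / 2" using B(1) by (simp add: \<delta>_def)
    moreover have "(l2norm M (\<lambda>x. u i x - u l x))\<^sup>2 = (x - y)\<^sup>2 + (x + y - 2 * z) * (x + y + 2 * z)"
      unfolding l2norm_parallelogram[OF u u] x_def[symmetric] y_def[symmetric] z_def[symmetric]
      by algebra
    moreover have "(e / 2)\<^sup>2 + e\<^sup>2 / 2 < e\<^sup>2"
      using \<open>e > 0\<close> by (simp add: power2_eq_square)
    ultimately have "(l2norm M (\<lambda>x. u i x - u l x))\<^sup>2 < e\<^sup>2" by linarith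
    then show ?thesis using \<open>e > 0\<close> by (simp add: power2_less_imp_less)
  qed
  then show ?thesis by blast
qed

section \<open>Limits of periodic L^2 functions\<close>

lemma l2norm_circle_frac: "l2norm circle_measure (\<lambda>x. f x - g (frac x)) = l2norm circle_measure (\<lambda>x. f x - g x)"
proof -
  have "(LINT x|circle_measure. (f x - g (frac x))\<^sup>2) = (LINT x|circle_measure. (f x - g x)\<^sup>2)"
    by (rule Bochner_Integration.integral_cong) (auto simp: frac_eq)
  then show ?thesis by (simp add: l2norm_def)
qed

lemma L2_circle_frac: "square_integrable circle_measure g \<Longrightarrow> L2_circle (\<lambda>x. g (frac x))"
proof -
  assume g: "square_integrable circle_measure g"
  have "(\<lambda>x. g (frac x)) \<in> borel_measurable circle_measure \<longleftrightarrow> g \<in> borel_measurable circle_measure"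
    by (rule measurable_cong) (auto simp: frac_eq)
  moreover have "integrable circle_measure (\<lambda>x. (g (frac x))\<^sup>2) \<longleftrightarrow> integrable circle_measure (\<lambda>x. (g x)\<^sup>2)"
    by (rule Bochner_Integration.integrable_cong) (auto simp: frac_eq)
  ultimately show ?thesis
    using g by (auto simp: L2_circle_iff square_integrable_def intro!: periodicI_frac)
qed

text \<open>The limit given by completeness is constrained only on [0,1). Composing with
  \<open>frac\<close> restores periodicity and changes nothing there.\<close>

lemma L2_circle_complete:
  assumes "\<And>n::nat. L2_circle (f n)"
    and "\<And>e. e > 0 \<Longrightarrow> \<exists>N. \<forall>m\<ge>N. \<forall>n\<ge>N. l2norm circle_measure (\<lambda>x. f m x - f n x) < e"
  shows "\<exists>g. L2_circle g \<and> (\<lambda>n. l2norm circle_measure (\<lambda>x. f n x - g x)) \<longlonglongrightarrow> 0"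
proof -
  obtain g where "square_integrable circle_measure g"
      "(\<lambda>n. l2norm circle_measure (\<lambda>x. f n x - g x)) \<longlonglongrightarrow> 0"
    using circle.square_integrable_complete[of f] assms by (auto simp: L2_circle_iff)
  then have "L2_circle (\<lambda>x. g (frac x)) \<and>
      (\<lambda>n. l2norm circle_measure (\<lambda>x. f n x - g (frac x))) \<longlonglongrightarrow> 0"
    by (simp add: L2_circle_frac l2norm_circle_frac)
  then show ?thesis by blast
qed

lemma l2_tendsto_integral_mult:
  assumes "\<And>n. square_integrable M (f n)" "square_integrable M g" "square_integrable M h"
    and "(\<lambda>n. l2norm M (\<lambda>x. f n x - g x)) \<longlonglongrightarrow> 0"
  shows "(\<lambda>n. LINT x|M. f n x * h x) \<longlonglongrightarrow> (LINT x|M. g x * h x)"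
proof (rule LIM_zero_cancel, rule Lim_null_comparison)
  show "(\<lambda>n. l2norm M (\<lambda>x. f n x - g x) * l2norm M h) \<longlonglongrightarrow> 0"
    by (rule tendsto_mult_left_zero[OF assms(4)])
  have "\<bar>(LINT x|M. f n x * h x) - (LINT x|M. g x * h x)\<bar> \<le> l2norm M (\<lambda>x. f n x - g x) * l2norm M h" for n
    using l2norm_cauchy_schwarz[OF square_integrable_diff[OF assms(1)[of n] assms(2)] assms(3)]
      square_integrable_mult[OF assms(1)[of n] assms(3)] square_integrable_mult[OF assms(2,3)]
    by (simp add: left_diff_distrib)
  then show "\<forall>\<^sub>F n in sequentially. norm ((LINT x|M. f n x * h x) - (LINT x|M. g x * h x))
      \<le> l2norm M (\<lambda>x. f n x - g x) * l2norm M h"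
    by simp
qed

text \<open>Weak differentiation is a closed operator: against a fixed test function both sides of
  the defining identity are continuous in L^2.\<close>

lemma is_weak_deriv_limit:
  assumes "\<And>n. L2_circle (f n)" "L2_circle g" "\<And>n. L2_circle (f' n)" "L2_circle g'"
    and "\<And>n. is_weak_deriv k (f n) (f' n)"
    and "(\<lambda>n. l2norm circle_measure (\<lambda>x. f n x - g x)) \<longlonglongrightarrow> 0"
    and "(\<lambda>n. l2norm circle_measure (\<lambda>x. f' n x - g' x)) \<longlonglongrightarrow> 0"
  shows "is_weak_deriv k g g'"
proof (rule is_weak_derivI)
  fix \<phi> assume \<phi>: "smooth_circle \<phi>"
  note si = assms(1-4)[unfolded L2_circle_iff, THEN conjunct2]
  have "(\<lambda>n. LINT x|circle_measure. f n x * (deriv ^^ k) \<phi> x) \<longlonglongrightarrow> (LINT x|circle_measure. g x * (deriv ^^ k) \<phi> x)"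
    by (intro l2_tendsto_integral_mult si smooth_circle_square_integrable smooth_circle_derivs \<phi> assms)
  moreover have "(\<lambda>n. (-1) ^ k * (LINT x|circle_measure. f' n x * \<phi> x)) \<longlonglongrightarrow> (-1) ^ k * (LINT x|circle_measure. g' x * \<phi> x)"
    by (intro tendsto_mult_left l2_tendsto_integral_mult si smooth_circle_square_integrable \<phi> assms)
  moreover have "(LINT x|circle_measure. f n x * (deriv ^^ k) \<phi> x) = (-1) ^ k * (LINT x|circle_measure. f' n x * \<phi> x)" for n
    by (rule is_weak_derivD[OF assms(5) \<phi>])
  ultimately show "(LINT x|circle_measure. g x * (deriv ^^ k) \<phi> x) = (-1) ^ k * (LINT x|circle_measure. g' x * \<phi> x)"
    by (simp add: LIMSEQ_unique)
qed

lemma is_weak_deriv_cong_AE: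
  assumes "square_integrable circle_measure f" "square_integrable circle_measure g"
    and "AE x in circle_measure. f x = g x" "is_weak_deriv k f h"
  shows "is_weak_deriv k g h"
proof (rule is_weak_derivI)
  fix \<phi> assume \<phi>: "smooth_circle \<phi>"
  have "(LINT x|circle_measure. g x * (deriv ^^ k) \<phi> x) = (LINT x|circle_measure. f x * (deriv ^^ k) \<phi> x)"
    using assms(1-3) smooth_circle_square_integrable[OF smooth_circle_derivs[OF \<phi>, of k]]
    by (intro integral_cong_AE) (auto simp: square_integrable_def)
  then show "(LINT x|circle_measure. g x * (deriv ^^ k) \<phi> x) = (-1) ^ k * (LINT x|circle_measure. h x * \<phi> x)"
    using is_weak_derivD[OF assms(4) \<phi>] by simp
qed

text \<open>Order 0 is set apart because \<open>weak_deriv 0 f\<close> would be a chosen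
  representative, equal to \<open>f\<close> only almost everywhere.\<close>

definition sobolev_deriv :: "nat \<Rightarrow> (real \<Rightarrow> real) \<Rightarrow> real \<Rightarrow> real" where
  "sobolev_deriv j f = (if j = 0 then f else weak_deriv j f)"

definition sobolev_norm :: "(nat \<Rightarrow> real) \<Rightarrow> nat \<Rightarrow> (real \<Rightarrow> real) \<Rightarrow> real" where
  "sobolev_norm w k f = (\<Sum>j\<le>k. w j * norm_L2 (sobolev_deriv j f))"

lemma norm_L2_nonneg [simp]: "norm_L2 f \<ge> 0"
  by (simp add: norm_L2_eq)

lemma L2_sobolev_deriv: "sobolev_H k f \<Longrightarrow> j \<le> k \<Longrightarrow> L2_circle (sobolev_deriv j f)"
  using weak_deriv_works(1)[of k f j] by (auto simp: sobolev_deriv_def sobolev_H_def)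

lemma square_integrable_sobolev_deriv:
  "sobolev_H k f \<Longrightarrow> j \<le> k \<Longrightarrow> square_integrable circle_measure (sobolev_deriv j f)"
  using L2_sobolev_deriv by (simp add: L2_circle_iff)

lemma norm_L2_sobolev_deriv_lincomb:
  assumes f: "sobolev_H k f" and g: "sobolev_H k g" and "j \<le> k"
  shows "norm_L2 (sobolev_deriv j (\<lambda>x. s * f x + t * g x)) =
    norm_L2 (\<lambda>x. s * sobolev_deriv j f x + t * sobolev_deriv j g x)"
proof -
  have "AE x in circle_measure. sobolev_deriv j (\<lambda>x. s * f x + t * g x) x =
      s * sobolev_deriv j f x + t * sobolev_deriv j g x"
    using sobolev_H_lincomb(2)[OF f g, of j s t] \<open>j \<le> k\<close>
    by (cases "j = 0") (auto simp: sobolev_deriv_def)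
  moreover have "square_integrable circle_measure (sobolev_deriv j (\<lambda>x. s * f x + t * g x))"
    by (rule square_integrable_sobolev_deriv[OF sobolev_H_lincomb(1)[OF f g] \<open>j \<le> k\<close>])
  moreover have "square_integrable circle_measure (\<lambda>x. s * sobolev_deriv j f x + t * sobolev_deriv j g x)"
    by (intro square_integrable_add square_integrable_scale square_integrable_sobolev_deriv[OF f \<open>j \<le> k\<close>]
        square_integrable_sobolev_deriv[OF g \<open>j \<le> k\<close>])
  ultimately show ?thesis
    unfolding norm_L2_eq by (intro l2norm_cong_AE) (auto simp: square_integrable_def)
qed

lemma sobolev_norm_scale_AE:
  assumes f: "sobolev_H k f" and g: "sobolev_H k g" and eq: "AE x in circle_measure. f x = s * g x"
  shows "sobolev_norm w k f = \<bar>s\<bar> * sobolev_norm w k g"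
proof -
  \<comment> \<open>The zero term turns the scaling into a two-term combination, so that linearity
    of the weak derivatives applies.\<close>
  let ?h = "\<lambda>x. s * g x + 0 * g x"
  have h: "sobolev_H k ?h" by (rule sobolev_H_lincomb(1)[OF g g])
  have "norm_L2 (sobolev_deriv j f) = \<bar>s\<bar> * norm_L2 (sobolev_deriv j g)" if "j \<le> k" for j
  proof -
    have "AE x in circle_measure. sobolev_deriv j f x = sobolev_deriv j ?h x"
    proof (cases "j = 0")
      case False
      have "is_weak_deriv j f (weak_deriv j ?h)"
      proof (rule is_weak_deriv_cong_AE)
        show "square_integrable circle_measure ?h" "square_integrable circle_measure f"
          using f h by (auto simp: sobolev_H_def L2_circle_iff)
        show "is_weak_deriv j ?h (weak_deriv j ?h)" using weak_deriv_works[OF h] False that by simp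
        show "AE x in circle_measure. ?h x = f x" using eq by auto
      qed
      then show ?thesis
        using weak_deriv_AE_eq weak_deriv_works[OF h, of j] False that by (auto simp: sobolev_deriv_def)
    qed (use eq in \<open>simp add: sobolev_deriv_def\<close>)
    then have "norm_L2 (sobolev_deriv j f) = norm_L2 (sobolev_deriv j ?h)"
      unfolding norm_L2_eq
      using square_integrable_sobolev_deriv[OF f that] square_integrable_sobolev_deriv[OF h that]
      by (intro l2norm_cong_AE) (auto simp: square_integrable_def)
    also have "\<dots> = norm_L2 (\<lambda>x. s * sobolev_deriv j g x)"
      using norm_L2_sobolev_deriv_lincomb[OF g g that, of s 0] by simp
    also have "\<dots> = \<bar>s\<bar> * norm_L2 (sobolev_deriv j g)"
      by (simp add: norm_L2_eq l2norm_scale)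
    finally show ?thesis .
  qed
  then show ?thesis
    unfolding sobolev_norm_def sum_distrib_left by (intro sum.cong) auto
qed

text \<open>The variational argument with the equation abstracted to a set \<open>A\<close>.
  Convexity enters only through midpoints, and closedness only for convergence of all derivatives up
  to order \<open>k\<close>.\<close>

theorem sobolev_norm_unique_minimizer:
  fixes w :: "nat \<Rightarrow> real" and A :: "(real \<Rightarrow> real) \<Rightarrow> bool"
  assumes w: "\<And>j. w j \<ge> 0" "w 0 > 0" "w k > 0" and "k \<ge> 1"
    and sob: "\<And>f. A f \<Longrightarrow> sobolev_H k f"
    and convex: "\<And>f g. A f \<Longrightarrow> A g \<Longrightarrow> A (\<lambda>x. 1/2 * f x + 1/2 * g x)"
    and closed: "\<And>F f. \<lbrakk>\<And>i::nat. A (F i); sobolev_H k f;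
      \<And>j. j \<le> k \<Longrightarrow> (\<lambda>i. norm_L2 (\<lambda>x. sobolev_deriv j (F i) x - sobolev_deriv j f x)) \<longlonglongrightarrow> 0\<rbrakk> \<Longrightarrow> A f"
    and nonempty: "A f0"
  shows "\<exists>f. is_arg_min (sobolev_norm w k) A f \<and>
    (\<forall>g. is_arg_min (sobolev_norm w k) A g \<longrightarrow> (AE x in circle_measure. g x = f x))"
proof -
  let ?N = "sobolev_norm w k"
  define n where "n j f = norm_L2 (sobolev_deriv j f)" for j f
  define mid where "mid f g x = 1/2 * f x + 1/2 * g x" for f g :: "real \<Rightarrow> real" and x
  have N: "?N f = (\<Sum>j\<le>k. w j * n j f)" for f
    by (simp add: sobolev_norm_def n_def)
  have n0: "n j f \<ge> 0" for j f by (simp add: n_def)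
  have N_ge: "w j * n j f \<le> ?N f" if "j \<le> k" for j f
    unfolding N using w(1) n0 that by (intro member_le_sum_atMost mult_nonneg_nonneg)
  have N_nonneg: "?N f \<ge> 0" for f
    unfolding N using w(1) n0 by (intro sum_nonneg mult_nonneg_nonneg)
  have n_mid: "n j (mid f g) = l2norm circle_measure (\<lambda>x. (sobolev_deriv j f x + sobolev_deriv j g x) / 2)"
    if "A f" "A g" "j \<le> k" for j f g
    using norm_L2_sobolev_deriv_lincomb[OF sob sob, of f g j "1/2" "1/2"] that
    by (simp add: n_def norm_L2_eq mid_def[abs_def] add_divide_distrib)
  have n_mid_le: "n j (mid f g) \<le> (n j f + n j g) / 2" if "A f" "A g" "j \<le> k" for j f g
    using l2norm_triangle[OF square_integrable_sobolev_deriv[OF sob] square_integrable_sobolev_deriv[OF sob], of f j g j]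
      l2norm_scale[of circle_measure "1/2" "\<lambda>x. sobolev_deriv j f x + sobolev_deriv j g x"] that
      n_mid[OF that]
    by (simp add: n_def norm_L2_eq)
  \<comment> \<open>By the triangle inequality every summand of the total defect is nonnegative, so
    a single one is at most the sum.\<close>
  have gap: "w j * (n j f + n j g - 2 * n j (mid f g)) \<le> ?N f + ?N g - 2 * ?N (mid f g)"
    if "A f" "A g" "j \<le> k" for j f g
  proof -
    have "w j * (n j f + n j g - 2 * n j (mid f g)) \<le> (\<Sum>i\<le>k. w i * (n i f + n i g - 2 * n i (mid f g)))"
    proof (intro member_le_sum_atMost mult_nonneg_nonneg w(1) that)
      fix i assume "i \<le> k"
      then show "0 \<le> n i f + n i g - 2 * n i (mid f g)" using n_mid_le[OF that(1,2), of i] by simp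
    qed
    also have "\<dots> = ?N f + ?N g - 2 * ?N (mid f g)"
      by (simp add: N sum.distrib sum_subtractf sum_distrib_left algebra_simps)
    finally show ?thesis .
  qed
  have A_mid: "A (mid f g)" if "A f" "A g" for f g
    using convex[OF that] by (simp add: mid_def[abs_def])
  define \<mu> where "\<mu> = Inf (?N ` {f. A f})"
  have bdd: "bdd_below (?N ` {f. A f})" using N_nonneg by (intro bdd_belowI[of _ 0]) auto
  have \<mu>_le: "\<mu> \<le> ?N f" if "A f" for f
    unfolding \<mu>_def using that by (intro cInf_lower bdd) auto
  have "\<exists>f. A f \<and> ?N f < \<mu> + 1 / real (Suc i)" for i
  proof -
    have "Inf (?N ` {f. A f}) < \<mu> + 1 / real (Suc i)" unfolding \<mu>_def by simp
    then show ?thesis using nonempty by (subst (asm) cInf_less_iff[OF _ bdd]) auto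
  qed
  then obtain f where Af: "\<And>i. A (f i)" and Nf: "\<And>i. ?N (f i) < \<mu> + 1 / real (Suc i)"
    by metis
  have n_bound: "n j (f i) \<le> (\<mu> + 1) / w j" if "j \<le> k" "w j > 0" for i j
  proof -
    have "1 / real (Suc i) \<le> 1" by simp
    then have "w j * n j (f i) \<le> \<mu> + 1" using N_ge[OF that(1), of "f i"] Nf[of i] by linarith
    then show ?thesis using that(2) by (simp add: field_simps)
  qed
  \<comment> \<open>Pairing the two norms in the plane yields one subsequence along which both
    converge.\<close>
  have "bounded (range (\<lambda>i. (n 0 (f i), n k (f i))))"
  proof (rule bounded_subset)
    show "range (\<lambda>i. (n 0 (f i), n k (f i))) \<subseteq> {0..(\<mu> + 1) / w 0} \<times> {0..(\<mu> + 1) / w k}"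
      using n0 n_bound w by auto
    show "bounded ({0..(\<mu> + 1) / w 0} \<times> {0..(\<mu> + 1) / w k})"
      by (intro bounded_Times bounded_closed_interval)
  qed
  then obtain L r where r: "strict_mono (r :: nat \<Rightarrow> nat)" and
    L: "((\<lambda>i. (n 0 (f i), n k (f i))) \<circ> r) \<longlonglongrightarrow> L"
    using bounded_imp_convergent_subsequence by blast
  define F where "F i = f (r i)" for i
  have AF: "A (F i)" for i by (simp add: F_def Af)
  note sobF = sob[OF AF]
  have NF: "?N (F i) \<le> \<mu> + 1 / real (Suc i)" for i
  proof -
    have "1 / real (Suc (r i)) \<le> 1 / real (Suc i)"
      using seq_suble[OF r, of i] by (intro divide_left_mono) auto
    then show ?thesis using Nf[of "r i"] by (simp add: F_def)
  qed
  have conv: "convergent (\<lambda>i. n 0 (F i))" "convergent (\<lambda>i. n k (F i))"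
    using tendsto_fst[OF L] tendsto_snd[OF L] by (auto simp: F_def o_def convergent_def)
  have Cauchy: "\<exists>N. \<forall>i\<ge>N. \<forall>l\<ge>N. l2norm circle_measure (\<lambda>x. sobolev_deriv j (F i) x - sobolev_deriv j (F l) x) < e"
    if "e > 0" "j \<le> k" "w j > 0" "convergent (\<lambda>i. n j (F i))" for j e
  proof (rule l2norm_midpoint_Cauchy[OF square_integrable_sobolev_deriv[OF sobF that(2)]])
    show "convergent (\<lambda>i. l2norm circle_measure (sobolev_deriv j (F i)))"
      using that(4) by (simp add: n_def norm_L2_eq)
    fix e :: real assume "e > 0"
    \<comment> \<open>Beyond \<open>N\<close> both members exceed \<open>\<mu>\<close> by at most
      1/N and their midpoint has norm at least \<open>\<mu>\<close>, so the total defect is at most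
      2/N; this has to stay below \<open>w j * e\<close>.\<close>
    obtain N :: nat where "2 / (w j * e) < N" using reals_Archimedean2 by blast
    then have "2 < real N * (w j * e)"
      using \<open>e > 0\<close> \<open>w j > 0\<close> by (simp add: pos_divide_less_eq)
    moreover from this have "N > 0" by (intro Nat.gr0I) simp
    ultimately have N: "2 / real N \<le> w j * e" "N > 0"
      by (simp_all add: pos_divide_le_eq mult.commute)
    have "n j (F i) + n j (F l) - 2 * n j (mid (F i) (F l)) \<le> e" if "i \<ge> N" "l \<ge> N" for i l
    proof -
      have "1 / real (Suc i) \<le> 1 / real N" "1 / real (Suc l) \<le> 1 / real N"
        using that N by (auto intro!: divide_left_mono)
      moreover have "w j * (n j (F i) + n j (F l) - 2 * n j (mid (F i) (F l))) \<le>
          ?N (F i) + ?N (F l) - 2 * ?N (mid (F i) (F l))"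
        by (rule gap[OF AF AF \<open>j \<le> k\<close>])
      ultimately have "w j * (n j (F i) + n j (F l) - 2 * n j (mid (F i) (F l))) \<le> w j * e"
        using NF[of i] NF[of l] \<mu>_le[OF A_mid[OF AF AF], of i l] N(1) by linarith
      then show ?thesis using \<open>w j > 0\<close> by simp
    qed
    then show "\<exists>N. \<forall>i\<ge>N. \<forall>l\<ge>N. l2norm circle_measure (sobolev_deriv j (F i)) +
        l2norm circle_measure (sobolev_deriv j (F l)) -
        2 * l2norm circle_measure (\<lambda>x. (sobolev_deriv j (F i) x + sobolev_deriv j (F l) x) / 2) \<le> e"
      using n_mid[OF AF AF \<open>j \<le> k\<close>] by (auto simp: n_def norm_L2_eq)
  qed fact
  obtain g where g: "L2_circle g"
    "(\<lambda>i. l2norm circle_measure (\<lambda>x. sobolev_deriv 0 (F i) x - g x)) \<longlonglongrightarrow> 0"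
    using L2_circle_complete[OF L2_sobolev_deriv[OF sobF, of 0] Cauchy[of _ 0]] w conv by auto
  obtain g' where g': "L2_circle g'"
    "(\<lambda>i. l2norm circle_measure (\<lambda>x. sobolev_deriv k (F i) x - g' x)) \<longlonglongrightarrow> 0"
    using L2_circle_complete[OF L2_sobolev_deriv[OF sobF, of k] Cauchy[of _ k]] w conv by auto
  have wk: "is_weak_deriv k g g'"
  proof (rule is_weak_deriv_limit[OF _ g(1) _ g'(1) _ g(2) g'(2)])
    show "is_weak_deriv k (sobolev_deriv 0 (F i)) (sobolev_deriv k (F i))" for i
      using weak_deriv_works(2)[OF sobF] \<open>k \<ge> 1\<close> by (simp add: sobolev_deriv_def)
  qed (intro L2_sobolev_deriv[OF sobF]; simp)+
  have sobg: "sobolev_H k g" by (rule sobolev_HI[OF g(1) g'(1) wk])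
  have lim: "(\<lambda>i. norm_L2 (\<lambda>x. sobolev_deriv j (F i) x - sobolev_deriv j g x)) \<longlonglongrightarrow> 0" if "j \<le> k" for j
  proof (cases "j = 0")
    case True
    then show ?thesis using g(2) by (simp add: norm_L2_eq sobolev_deriv_def)
  next
    case False
    have ae: "AE x in circle_measure. sobolev_deriv k g x = g' x"
      using weak_deriv_AE_eq[OF g'(1) wk] \<open>k \<ge> 1\<close> by (simp add: sobolev_deriv_def)
    \<comment> \<open>The difference to the limit is again a Sobolev function, so its derivative of
      order \<open>j\<close> is bounded by the one of order \<open>k\<close>, which tends to
      0.\<close>
    let ?d = "\<lambda>i x. 1 * F i x + (-1) * g x"
    have D: "norm_L2 (sobolev_deriv j (?d i)) = norm_L2 (\<lambda>x. sobolev_deriv j (F i) x - sobolev_deriv j g x)"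
      if "j \<le> k" for i j
      using norm_L2_sobolev_deriv_lincomb[OF sobF[of i] sobg that, of 1 "-1"] by simp
    have Dk: "norm_L2 (\<lambda>x. sobolev_deriv k (F i) x - sobolev_deriv k g x) =
        l2norm circle_measure (\<lambda>x. sobolev_deriv k (F i) x - g' x)" for i
      unfolding norm_L2_eq
    proof (rule l2norm_cong_AE)
      show "AE x in circle_measure. sobolev_deriv k (F i) x - sobolev_deriv k g x = sobolev_deriv k (F i) x - g' x"
        using ae by eventually_elim simp
    qed (use g'(1) square_integrable_sobolev_deriv[OF sobF, of k i] square_integrable_sobolev_deriv[OF sobg, of k]
        in \<open>auto simp: L2_circle_iff square_integrable_def\<close>)
    show ?thesis
    proof (rule Lim_null_comparison)
      show "(\<lambda>i. 2 ^ (k - j) * l2norm circle_measure (\<lambda>x. sobolev_deriv k (F i) x - g' x)) \<longlonglongrightarrow> 0"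
        using tendsto_mult_right_zero[OF g'(2)] .
      have "norm_L2 (sobolev_deriv j (?d i)) \<le> 2 ^ (k - j) * norm_L2 (sobolev_deriv k (?d i))" for i
        using norm_weak_deriv_le[OF sobolev_H_lincomb(1)[OF sobF[of i] sobg, of 1 "-1"], of j] that False \<open>k \<ge> 1\<close>
        by (simp add: sobolev_deriv_def)
      then show "\<forall>\<^sub>F i in sequentially. norm (norm_L2 (\<lambda>x. sobolev_deriv j (F i) x - sobolev_deriv j g x))
          \<le> 2 ^ (k - j) * l2norm circle_measure (\<lambda>x. sobolev_deriv k (F i) x - g' x)"
        using D[OF that] D[of k] Dk by simp
    qed
  qed
  have Ag: "A g" by (rule closed[OF AF sobg lim])
  have "(\<lambda>i. n j (F i)) \<longlonglongrightarrow> n j g" if "j \<le> k" for j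
  proof (rule LIM_zero_cancel, rule Lim_null_comparison[OF _ lim[OF that]])
    show "\<forall>\<^sub>F i in sequentially. norm (n j (F i) - n j g) \<le> norm_L2 (\<lambda>x. sobolev_deriv j (F i) x - sobolev_deriv j g x)"
      using l2norm_triangle_diff[OF square_integrable_sobolev_deriv[OF sobF that]
        square_integrable_sobolev_deriv[OF sobg that]]
      by (simp add: n_def norm_L2_eq)
  qed
  then have "(\<lambda>i. ?N (F i)) \<longlonglongrightarrow> ?N g"
    unfolding N by (intro tendsto_sum tendsto_mult_left) auto
  moreover have "(\<lambda>i. \<mu> + 1 / real (Suc i)) \<longlonglongrightarrow> \<mu> + 0"
    by (intro tendsto_add tendsto_const LIMSEQ_Suc[OF lim_1_over_n])
  ultimately have "?N g \<le> \<mu> + 0"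
    by (rule LIMSEQ_le) (use NF in auto)
  then have Ng: "?N g = \<mu>" using \<mu>_le[OF Ag] by simp
  \<comment> \<open>Kept general in the pair, because either of the two norms may be the positive
    one. The factor satisfies \<mu> = s \<mu>, and a positive L^2 norm of \<open>h'\<close> forces
    \<mu> > 0.\<close>
  have proportional: "AE x in circle_measure. h x = h' x"
    if "A h" "A h'" "?N h = \<mu>" "?N h' = \<mu>" "norm_L2 h' > 0"
      "AE x in circle_measure. norm_L2 h' * h x = norm_L2 h * h' x" for h h'
  proof -
    define s where "s = norm_L2 h / norm_L2 h'"
    have hs: "AE x in circle_measure. h x = s * h' x"
      using that(6) by eventually_elim (use that(5) in \<open>simp add: s_def field_simps\<close>)
    have "s \<ge> 0" by (simp add: s_def)
    then have "\<mu> = s * \<mu>"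
      using sobolev_norm_scale_AE[OF sob[OF that(1)] sob[OF that(2)] hs, of w] that(3,4) by simp
    moreover have "\<mu> > 0"
    proof -
      have "0 < w 0 * n 0 h'" using w(2) that(5) by (simp add: n_def sobolev_deriv_def)
      also have "\<dots> \<le> \<mu>" using N_ge[of 0 h'] that(4) by simp
      finally show ?thesis .
    qed
    ultimately have "s = 1" by simp
    then show ?thesis using hs by simp
  qed
  have unique: "AE x in circle_measure. h x = g x" if "A h" "?N h = \<mu>" for h
  proof -
    have si: "square_integrable circle_measure h" "square_integrable circle_measure g"
      using sob[OF \<open>A h\<close>] sobg by (auto simp: sobolev_H_def L2_circle_iff)
    \<comment> \<open>The midpoint of two minimizers lies in \<open>A\<close>, so the total defect
      cannot be positive; the defect of order 0 then vanishes, which is equality in the triangle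
      inequality.\<close>
    have "w 0 * (n 0 h + n 0 g - 2 * n 0 (mid h g)) \<le> 0"
      using gap[OF \<open>A h\<close> Ag, of 0] \<mu>_le[OF A_mid[OF \<open>A h\<close> Ag]] that(2) Ng by simp
    then have "n 0 h + n 0 g - 2 * n 0 (mid h g) \<le> 0"
      using w(2) by (simp add: mult_le_0_iff)
    then have "n 0 (mid h g) = (n 0 h + n 0 g) / 2"
      using n_mid_le[OF \<open>A h\<close> Ag, of 0] by simp
    then have eq: "AE x in circle_measure. norm_L2 g * h x = norm_L2 h * g x"
      unfolding norm_L2_eq using n_mid[OF \<open>A h\<close> Ag, of 0] si
      by (intro l2norm_triangle_equality) (auto simp: n_def norm_L2_eq sobolev_deriv_def)
    consider "norm_L2 g > 0" | "norm_L2 h > 0" | "norm_L2 g = 0" "norm_L2 h = 0"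
      using norm_L2_nonneg[of g] norm_L2_nonneg[of h] by linarith
    then show ?thesis
    proof cases
      case 1
      then show ?thesis using proportional[OF that(1) Ag that(2) Ng _ eq] by simp
    next
      case 2
      have "AE x in circle_measure. norm_L2 h * g x = norm_L2 g * h x" using eq by auto
      then have "AE x in circle_measure. g x = h x"
        by (rule proportional[OF Ag that(1) Ng that(2) 2])
      then show ?thesis by auto
    next
      case 3
      then have "AE x in circle_measure. g x = 0" "AE x in circle_measure. h x = 0"
        using l2norm_eq_0_iff[OF si(1)] l2norm_eq_0_iff[OF si(2)] by (auto simp: norm_L2_eq)
      then show ?thesis by eventually_elim simp
    qed
  qed
  have min: "is_arg_min ?N A h \<longleftrightarrow> A h \<and> ?N h = \<mu>" for h
  proof
    assume h: "is_arg_min ?N A h"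
    then have "\<not> ?N g < ?N h" "A h" using Ag by (auto simp: is_arg_min_def)
    then show "A h \<and> ?N h = \<mu>" using \<mu>_le[of h] Ng by simp
  next
    assume "A h \<and> ?N h = \<mu>"
    then show "is_arg_min ?N A h"
      using \<mu>_le by (auto simp: is_arg_min_def not_less)
  qed
  show ?thesis
    using min Ag Ng unique by blast
qed

section \<open>The transfer operator of an expanding map\<close>

lemma AE_circle_iff_negligible:
  "(AE x in circle_measure. P x) \<longleftrightarrow> negligible {x \<in> {0..<1}. \<not> P x}"
proof -
  have "(AE x in circle_measure. P x) \<longleftrightarrow> (AE x in lebesgue. x \<in> {0..<1} \<longrightarrow> P x)"
    by (simp add: AE_restrict_space_iff)
  also have "\<dots> \<longleftrightarrow> {x \<in> {0..<1}. \<not> P x} \<in> null_sets lebesgue"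
  proof
    assume "AE x in lebesgue. x \<in> {0..<1} \<longrightarrow> P x"
    then obtain N where "{x. \<not> (x \<in> {0..<1} \<longrightarrow> P x)} \<subseteq> N" "N \<in> null_sets lebesgue"
      by (auto simp: eventually_ae_filter)
    then show "{x \<in> {0..<1}. \<not> P x} \<in> null_sets lebesgue"
      by (auto simp: negligible_iff_null_sets[symmetric] intro: negligible_subset)
  next
    assume "{x \<in> {0..<1}. \<not> P x} \<in> null_sets lebesgue"
    then show "AE x in lebesgue. x \<in> {0..<1} \<longrightarrow> P x"
      by (rule AE_I') auto
  qed
  finally show ?thesis by (simp add: negligible_iff_null_sets)
qed

text \<open>The continuous function (f - g)^2 has integral 0 over a period, so it vanishes on [0,1],
  and periodicity does the rest.\<close>

lemma periodic_continuous_AE_eq: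
  fixes f g :: "real \<Rightarrow> real"
  assumes "continuous_on UNIV f" "continuous_on UNIV g"
    and "periodic_fun_simple' f" "periodic_fun_simple' g"
    and ae: "AE x in circle_measure. f x = g x"
  shows "f = g"
proof
  fix x
  have cont: "continuous_on {0..1} (\<lambda>x. (f x - g x)\<^sup>2)"
    using assms(1,2) by (intro continuous_intros) (auto intro: continuous_on_subset)
  have "(LINT x|circle_measure. (f x - g x)\<^sup>2) = 0"
    using ae by (intro integral_eq_zero_AE) auto
  then have "integral {0..1} (\<lambda>x. (f x - g x)\<^sup>2) = 0"
    using circle_integrable_continuous(2)[OF cont] by simp
  then have "((\<lambda>x. (f x - g x)\<^sup>2) has_integral 0) (cbox 0 1)"
    using integrable_integral[OF integrable_continuous_interval[OF cont]] by simp
  then have "(f (frac x) - g (frac x))\<^sup>2 = 0"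
    using cont by (intro has_integral_0_cbox_imp_0[of 0 1 "\<lambda>x. (f x - g x)\<^sup>2"])
      (auto simp: less_imp_le[OF frac_lt_1])
  then show "f x = g x"
    using periodic_frac[OF assms(3), of x] periodic_frac[OF assms(4), of x] by simp
qed

text \<open>The lift is a homeomorphism of the line, so all inverse branches of the circle map come
  from its single inverse \<open>S\<close>, as x -> S(x + k) for k < m.\<close>

locale expanding_lift =
  fixes T :: "real \<Rightarrow> real" and m :: nat and c :: real
  assumes C1: "C_k 1 T" and m: "m \<ge> 2" and degree: "\<And>x. T (x + 1) = T x + real m"
    and c: "c > 1" and expanding: "\<And>x. deriv T x \<ge> c"
begin

lemma DERIV_T: "(T has_real_derivative deriv T x) (at x)"
  using C1 C_k_Suc_DERIV by simp

lemma deriv_T_pos: "deriv T x > 0"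
  using c expanding[of x] by simp

lemma T_expands: "x \<le> y \<Longrightarrow> c * (y - x) \<le> T y - T x"
proof (cases "x = y")
  case False
  assume "x \<le> y"
  then have "x < y" using False by simp
  from MVT2[OF this, of T "deriv T"] obtain z where z: "T y - T x = (y - x) * deriv T z"
    using DERIV_T by blast
  show ?thesis
    unfolding z using mult_left_mono[OF expanding[of z], of "y - x"] \<open>x < y\<close> by (simp add: mult.commute)
qed simp

lemma T_expands_abs: "c * \<bar>y - x\<bar> \<le> \<bar>T y - T x\<bar>"
proof (cases "x \<le> y")
  case True
  then show ?thesis using T_expands[of x y] by simp
next
  case False
  then have "c * (x - y) \<le> T x - T y" "\<bar>y - x\<bar> = x - y" using T_expands[of y x] by simp_all
  then show ?thesis by simp
qed

lemma inj_T: "T x = T y \<Longrightarrow> x = y"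
  using T_expands_abs[of x y] c by (simp add: mult_le_0_iff)

lemma continuous_T: "continuous_on A T"
  using C1 by (rule C_k_continuous)

lemma surj_T: "\<exists>x. T x = y"
proof -
  \<comment> \<open>Chosen so that expansion from 0 over a distance \<open>b\<close> covers at least
    |y - T 0| in either direction.\<close>
  define b where "b = \<bar>y - T 0\<bar> / c"
  have "b \<ge> 0" using c by (simp add: b_def)
  have "c * b = \<bar>y - T 0\<bar>" using c by (simp add: b_def)
  then have "T (- b) \<le> y" "y \<le> T b"
    using T_expands[of 0 b] T_expands[of "- b" 0] \<open>b \<ge> 0\<close> by (auto simp: abs_if split: if_splits)
  then show ?thesis
    using IVT'[of T "- b" y b] continuous_T \<open>b \<ge> 0\<close> by auto
qed

definition S :: "real \<Rightarrow> real" where "S = inv T"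

lemma T_S [simp]: "T (S x) = x"
  unfolding S_def using surj_T by (intro f_inv_into_f) (metis rangeI)

lemma S_T [simp]: "S (T x) = x"
  by (rule inj_T) simp


lemma isCont_S: "isCont S x"
proof -
  have "isCont S (T (S x))"
    using DERIV_isCont[OF DERIV_T] by (intro isCont_inverse_function[of 1 "S x" S T]) auto
  then show ?thesis by simp
qed

lemma continuous_S: "continuous_on A S"
  using isCont_S by (simp add: continuous_at_imp_continuous_on)

lemma DERIV_S: "(S has_real_derivative 1 / deriv T (S x)) (at x)"
  using DERIV_inverse_function[where f = T and g = S and x = x and D = "deriv T (S x)"
      and a = "x - 1" and b = "x + 1"] DERIV_T deriv_T_pos[of "S x"] isCont_S by (simp add: inverse_eq_divide)

text \<open>Bootstrapping: if \<open>S\<close> is of class C^n, so is its derivative 1 / T'(S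
  x).\<close>

lemma C_k_S: "C_k n T \<Longrightarrow> C_k n S"
proof (induction n)
  case 0
  show ?case using isCont_S by (simp add: C_k_0 continuous_on_eq_continuous_at)
next
  case (Suc n)
  have "C_k n (\<lambda>x. 1 / deriv T (S x))"
  proof (rule C_k_reciprocal)
    show "C_k n (\<lambda>x. deriv T (S x))"
      by (rule C_k_compose[OF C_k_deriv[OF Suc.prems] Suc.IH[OF C_k_SucD[OF Suc.prems]]])
    show "deriv T (S x) \<noteq> 0" for x using deriv_T_pos[of "S x"] by linarith
  qed
  then show ?case by (rule C_k_SucI[OF DERIV_S])
qed

lemma T_add_int: "T (x + of_int j) = T x + real m * of_int j"
proof -
  have "periodic_fun_simple' (\<lambda>x. T x - real m * x)"
    by unfold_locales (simp add: degree algebra_simps)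
  from periodic_add_int[OF this, of x j] show ?thesis by (simp add: algebra_simps)
qed

lemma S_add: "S (x + real m * of_int j) = S x + of_int j"
  by (rule inj_T) (simp add: T_add_int)

lemma S_add_degree: "S (x + real m) = S x + 1"
  using S_add[of x 1] by simp

lemma periodic_deriv_T: "periodic_fun_simple' (deriv T)"
proof
  fix x :: real
  have "((\<lambda>y. T (y + 1)) has_real_derivative deriv T (x + 1)) (at x)"
    using DERIV_T[of "x + 1"] by (simp add: DERIV_shift)
  moreover have "((\<lambda>y. T (y + 1)) has_real_derivative deriv T x) (at x)"
    unfolding degree using DERIV_T by (auto intro!: derivative_eq_intros)
  ultimately show "deriv T (x + 1) = deriv T x" by (rule DERIV_unique)
qed

text \<open>The preimages of the circle point x are the classes of S(x + i) for integers i. Adding m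
  to i moves S by 1, so only i modulo m matters; conversely, equal classes force m to divide the
  difference of the indices.\<close>

lemma bij_betw_preimages:
  "bij_betw (\<lambda>k. frac (S (x + real k))) {..<m} {y \<in> {0..<1}. T y - x \<in> \<int>}"
proof (rule bij_betw_imageI)
  show "inj_on (\<lambda>k. frac (S (x + real k))) {..<m}"
  proof (rule inj_onI)
    fix k l assume kl: "k \<in> {..<m}" "l \<in> {..<m}" "frac (S (x + real k)) = frac (S (x + real l))"
    define j where "j = \<lfloor>S (x + real k)\<rfloor> - \<lfloor>S (x + real l)\<rfloor>"
    have "S (x + real k) = S (x + real l) + of_int j"
      using kl(3) by (simp add: frac_def j_def)
    then have "T (S (x + real k)) = T (S (x + real l)) + real m * of_int j"
      by (simp only: T_add_int)
    then have "real_of_int (int k - int l) = real_of_int (int m * j)" by simp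
    then have kl': "int k - int l = int m * j" by (simp only: of_int_eq_iff)
    have "\<bar>int k - int l\<bar> < int m" using kl(1,2) by auto
    then have "j = 0" unfolding kl' using m by (simp add: abs_mult mult_less_cancel_left1)
    then show "k = l" using kl' by simp
  qed
  show "(\<lambda>k. frac (S (x + real k))) ` {..<m} = {y \<in> {0..<1}. T y - x \<in> \<int>}"
  proof (intro equalityI subsetI)
    fix y assume "y \<in> (\<lambda>k. frac (S (x + real k))) ` {..<m}"
    then obtain k where k: "y = frac (S (x + real k))" by auto
    have "T y = x + real k + real m * of_int (- \<lfloor>S (x + real k)\<rfloor>)"
      using T_add_int[of "S (x + real k)" "- \<lfloor>S (x + real k)\<rfloor>"] by (simp add: k frac_def)
    then have "T y - x = of_int (int k + int m * (- \<lfloor>S (x + real k)\<rfloor>))" by simp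
    then have "T y - x \<in> \<int>" by (metis Ints_of_int)
    then show "y \<in> {y \<in> {0..<1}. T y - x \<in> \<int>}" by (simp add: k frac_lt_1)
  next
    fix y assume "y \<in> {y \<in> {0..<1}. T y - x \<in> \<int>}"
    then obtain i where y: "0 \<le> y" "y < 1" and i: "T y = x + of_int i"
      by (auto elim!: Ints_cases simp: algebra_simps)
    define q k where "q = i div int m" and "k = nat (i mod int m)"
    have k: "k < m" "i = int k + int m * q" using m by (auto simp: k_def q_def nat_less_iff)
    have "S (x + real k) = S (T y + real m * of_int (- q))"
      using i k(2) by simp
    also have "\<dots> = y + of_int (- q)" by (simp only: S_add S_T)
    finally have "frac (S (x + real k)) = y"
      using y by (simp add: frac_unique_iff)
    then show "y \<in> (\<lambda>k. frac (S (x + real k))) ` {..<m}" using k(1) by force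
  qed
qed

text \<open>A sum over a fixed index set, with smooth dependence on \<open>x\<close>, can be
  differentiated term by term; the sum over preimages in [0,1) cannot be handled this way.\<close>

lemma transfer_operator_eq:
  assumes "periodic_fun_simple' w"
  shows "transfer_operator T w x = (\<Sum>k<m. w (S (x + real k)) / deriv T (S (x + real k)))"
  unfolding transfer_operator_def sum.reindex_bij_betw[OF bij_betw_preimages, symmetric]
  by (simp add: periodic_frac[OF assms] periodic_frac[OF periodic_deriv_T])

text \<open>The exceptional x lie in the countable union of the sets T(N) - j, where N is the
  exceptional set for \<open>P\<close>; differentiable images of null sets are null.\<close>

lemma AE_preimages:
  assumes "AE y in circle_measure. P y"
  shows "AE x in circle_measure. \<forall>y\<in>{y \<in> {0..<1}. T y - x \<in> \<int>}. P y"
proof -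
  let ?N = "{y \<in> {0..<1}. \<not> P y}"
  have "negligible ?N" using assms by (simp add: AE_circle_iff_negligible)
  then have "negligible ((\<lambda>y. T y - of_int j) ` ?N)" for j :: int
    by (rule negligible_differentiable_image_negligible[OF order_refl])
      (intro differentiable_on_diff differentiable_on_const differentiable_at_imp_differentiable_on;
       use DERIV_T real_differentiable_def in blast)
  then have "negligible (\<Union>j::int. (\<lambda>y. T y - of_int j) ` ?N)"
    by (intro negligible_countable_Union) auto
  moreover have "{x \<in> {0..<1}. \<not> (\<forall>y\<in>{y \<in> {0..<1}. T y - x \<in> \<int>}. P y)} \<subseteq> (\<Union>j::int. (\<lambda>y. T y - of_int j) ` ?N)"
  proof
    fix x assume "x \<in> {x \<in> {0..<1}. \<not> (\<forall>y\<in>{y \<in> {0..<1}. T y - x \<in> \<int>}. P y)}"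
    then obtain y j where "y \<in> ?N" "T y - x = of_int j" by (auto elim!: Ints_cases)
    then have "x = T y - of_int j" by simp
    then show "x \<in> (\<Union>j::int. (\<lambda>y. T y - of_int j) ` ?N)" using \<open>y \<in> ?N\<close> by blast
  qed
  ultimately show ?thesis
    unfolding AE_circle_iff_negligible by (rule negligible_subset)
qed

section \<open>Pointwise invariance and positivity of the density\<close>

lemma invariant_density_everywhere:
  assumes "invariant_density T \<rho>" "continuous_on UNIV \<rho>"
  shows "\<rho> x \<ge> 0" and "(\<Sum>k<m. \<rho> (S (x + real k)) / deriv T (S (x + real k))) = \<rho> x"
proof -
  have per: "periodic_fun_simple' \<rho>" and nonneg: "AE x in circle_measure. 0 \<le> \<rho> x"
    and inv: "AE x in circle_measure. transfer_operator T \<rho> x = \<rho> x"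
    using assms(1) by (auto simp: invariant_density_def)
  \<comment> \<open>Nonnegativity is phrased as an identity between continuous periodic functions,
    so that it extends from almost every point to every point.\<close>
  have "(\<lambda>x. \<bar>\<rho> x\<bar>) = \<rho>"
  proof (rule periodic_continuous_AE_eq)
    show "AE x in circle_measure. \<bar>\<rho> x\<bar> = \<rho> x" using nonneg by auto
  qed (use assms(2) per in \<open>auto intro!: continuous_intros simp: periodic_fun_simple'_def\<close>)
  then show "\<rho> x \<ge> 0" by (metis abs_ge_zero)
  define L where "L x = (\<Sum>k<m. \<rho> (S (x + real k)) / deriv T (S (x + real k)))" for x
  have L: "transfer_operator T \<rho> = L"
    by (simp add: L_def fun_eq_iff transfer_operator_eq[OF per])
  have "L = \<rho>"
  proof (rule periodic_continuous_AE_eq)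
    have contS: "continuous_on UNIV (\<lambda>x. S (x + real k))" for k
      by (rule continuous_on_compose2[OF continuous_S[of UNIV]]) (auto intro!: continuous_intros)
    show "continuous_on UNIV L"
      unfolding L_def using deriv_T_pos C1
      by (intro continuous_intros continuous_on_compose2[OF assms(2) contS]
          continuous_on_compose2[OF C_k_continuous[OF C_k_deriv] contS]) (auto simp: less_le)
    show "periodic_fun_simple' L"
    proof
      fix x :: real
      define h where "h k = \<rho> (S (x + real k)) / deriv T (S (x + real k))" for k :: nat
      \<comment> \<open>Going once around the circle permutes the branches cyclically: the sum is
        shifted by one index, and branch \<open>m\<close> coincides with branch 0.\<close>
      have "L (x + 1) = (\<Sum>k<m. h (Suc k))" by (simp add: L_def h_def add_ac)
      also have "\<dots> = (\<Sum>k<Suc m. h k) - h 0" by (subst sum.lessThan_Suc_shift) simp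
      also have "h m = h 0"
        using periodic_deriv_T per by (simp add: h_def S_add_degree periodic_fun_simple'_def)
      then have "(\<Sum>k<Suc m. h k) - h 0 = L x" by (simp add: L_def h_def)
      finally show "L (x + 1) = L x" .
    qed
    show "AE x in circle_measure. L x = \<rho> x" using inv by (simp add: L)
  qed (use assms(2) per in auto)
  then show "(\<Sum>k<m. \<rho> (S (x + real k)) / deriv T (S (x + real k))) = \<rho> x"
    by (simp add: L_def fun_eq_iff)
qed

text \<open>A zero of the density propagates backwards along \<open>S\<close>, and backward orbits are dense.\<close>

lemma invariant_density_pos:
  assumes inv: "invariant_density T \<rho>" and cont: "continuous_on UNIV \<rho>"
  shows "\<rho> x > 0"
proof (rule ccontr)
  note ev = invariant_density_everywhere[OF inv cont]
  have per: "periodic_fun_simple' \<rho>" using inv by (simp add: invariant_density_def)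
  assume "\<not> \<rho> x > 0"
  then have "\<rho> x = 0" using ev(1)[of x] by simp
  define Z where "Z = {x. \<rho> x = 0}"
  have "x \<in> Z" by (simp add: Z_def \<open>\<rho> x = 0\<close>)
  have "closed Z"
    unfolding Z_def using cont by (intro closed_Collect_eq) auto
  \<comment> \<open>A vanishing sum of nonnegative terms has every term 0, in particular the branch
    k = 0.\<close>
  have ZS: "S q \<in> Z" if "q \<in> Z" for q
  proof -
    have "(\<Sum>k<m. \<rho> (S (q + real k)) / deriv T (S (q + real k))) = 0"
      using ev(2)[of q] that by (simp add: Z_def)
    then have "\<forall>k\<in>{..<m}. \<rho> (S (q + real k)) / deriv T (S (q + real k)) = 0"
      using ev(1) deriv_T_pos by (subst (asm) sum_nonneg_eq_0_iff) (auto intro!: divide_nonneg_pos)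
    then show ?thesis using m deriv_T_pos[of "S q"] by (auto simp: Z_def dest!: bspec[of _ _ 0])
  qed
  \<comment> \<open>By periodicity \<open>Z\<close> contains all integer translates of one
    zero.\<close>
  have le1: "infdist p Z \<le> 1" for p
  proof -
    have "x + of_int \<lfloor>p - x\<rfloor> \<in> Z"
      using \<open>\<rho> x = 0\<close> by (simp add: Z_def periodic_add_int[OF per])
    then have "infdist p Z \<le> dist p (x + of_int \<lfloor>p - x\<rfloor>)" by (rule infdist_le)
    also have "\<dots> \<le> 1" unfolding dist_real_def by linarith
    finally show ?thesis .
  qed
  \<comment> \<open>Any q in \<open>Z\<close> has S q in \<open>Z\<close>, and T expands the
    distance between p and S q by at least \<open>c\<close>.\<close>
  have contract: "c * infdist p Z \<le> infdist (T p) Z" for p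
  proof -
    have "c * infdist p Z \<le> dist (T p) q" if "q \<in> Z" for q
    proof -
      have "infdist p Z \<le> dist p (S q)" by (rule infdist_le[OF ZS[OF that]])
      also have "c * dist p (S q) \<le> dist (T p) q"
        using T_expands_abs[of p "S q"] by (simp add: dist_real_def)
      finally show ?thesis using c by simp
    qed
    then show ?thesis
      using \<open>x \<in> Z\<close> by (subst (2) infdist_notempty) (auto intro!: cINF_greatest)
  qed
  \<comment> \<open>The distance to \<open>Z\<close> grows at least like c^n along the forward orbit
    yet never exceeds 1, so it is 0 from the start.\<close>
  have pow: "c ^ n * infdist p Z \<le> 1" for n p
  proof (induction n arbitrary: p)
    case (Suc n)
    have "c ^ Suc n * infdist p Z \<le> c ^ n * infdist (T p) Z"
      using mult_left_mono[OF contract[of p], of "c ^ n"] c by (simp add: mult_ac)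
    also have "\<dots> \<le> 1" by (rule Suc)
    finally show ?case .
  qed (use le1 in simp)
  have "p \<in> Z" for p
  proof -
    have "infdist p Z = 0"
    proof (rule ccontr)
      assume "infdist p Z \<noteq> 0"
      then have pos: "infdist p Z > 0" using infdist_nonneg[of p Z] by linarith
      obtain n where "1 / infdist p Z < c ^ n" using real_arch_pow[OF c] by blast
      then show False using pow[of n p] pos by (simp add: field_simps)
    qed
    then show ?thesis
      using in_closed_iff_infdist_zero[OF \<open>closed Z\<close>] \<open>x \<in> Z\<close> by blast
  qed
  then have "(LINT x|circle_measure. \<rho> x) = 0" by (simp add: Z_def)
  then show False using inv by (simp add: invariant_density_def)
qed

end

section \<open>The response equation\<close>

context expanding_lift
begin

text \<open>The right side of the equation is recognised by differentiating
  \<open>\<L> h (x) = (\<Sum>k<m. h (S (x + k)) S' (x + k))\<close> for \<open>h = \<rho> \<epsilon>\<close>.\<close>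

lemma response_equation_solvable:
  assumes T: "C_k 5 T" and inv: "invariant_density T \<rho>" and \<rho>: "C_k_circle 4 \<rho>"
    and \<rho>1: "C_k_circle 3 \<rho>1"
  shows "\<exists>\<epsilon>. sobolev_H 4 \<epsilon> \<and> response_equation T \<rho> \<rho>1 \<epsilon>"
proof -
  have C\<rho>: "C_k 4 \<rho>" and per\<rho>: "periodic_fun_simple' \<rho>" and C\<rho>1: "C_k 3 \<rho>1" and per\<rho>1: "periodic_fun_simple' \<rho>1"
    using \<rho> \<rho>1 by (auto simp: C_k_circle_def)
  have \<rho>_cont: "continuous_on UNIV \<rho>" by (rule C_k_continuous[OF C\<rho>])
  note \<rho>_pos = invariant_density_pos[OF inv \<rho>_cont]
  note \<rho>_inv = invariant_density_everywhere(2)[OF inv \<rho>_cont]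
  have CT: "C_k 4 T" using C_k_mono[OF T] by simp
  have CS: "C_k 4 S" by (rule C_k_S[OF CT])
  obtain R where R: "\<And>x. (R has_real_derivative \<rho>1 x) (at x)" and CR: "C_k (Suc 3) R"
    using C_k_antiderivative[OF C\<rho>1] by blast
  \<comment> \<open>The mean of \<open>\<rho>1\<close>, in general nonzero, so \<open>R\<close>
    alone is not periodic.\<close>
  define I where "I = R 1 - R 0"
  have R_period: "R (x + 1) = R x + I" for x
  proof -
    have "((\<lambda>y. R (y + 1) - R y) has_real_derivative 0) (at y)" for y
      using R[of "y + 1"] R[of y] periodic_fun_simple'.plus_period[OF per\<rho>1, of y]
      by (auto intro!: derivative_eq_intros simp: DERIV_shift)
    then have "R (x + 1) - R x = R (0 + 1) - R 0"
      by (intro DERIV_isconst_all) auto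
    then show ?thesis by (simp add: I_def)
  qed
  \<comment> \<open>Each term R(S(x + k)) has derivative \<rho>1(S(x + k)) / T'(S(x + k)), so the
    sum is a primitive of L \<rho>1.\<close>
  define F where "F x = R x - (\<Sum>k<m. R (S (x + real k)))" for x
  have CSk: "C_k 4 (\<lambda>x. S (x + real k))" for k
    by (intro C_k_compose[OF CS] C_k_add C_k_ident C_k_const)
  have CF: "C_k 4 F"
    unfolding F_def using CR by (intro C_k_diff C_k_sum C_k_compose[OF _ CSk]) (simp_all add: eval_nat_numeral)
  have DERIV_Sk: "((\<lambda>x. S (x + real k)) has_real_derivative 1 / deriv T (S (x + real k))) (at x)" for x k
    using DERIV_S[of "x + real k"] by (simp add: DERIV_shift)
  have F: "(F has_real_derivative \<rho>1 x - transfer_operator T \<rho>1 x) (at x)" for x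
    unfolding F_def transfer_operator_eq[OF per\<rho>1]
    by (intro DERIV_diff R DERIV_sum)
      (use DERIV_chain2[OF R DERIV_Sk] in simp)
  have perF: "periodic_fun_simple' F"
  proof
    fix x :: real
    define h where "h k = R (S (x + real k))" for k :: nat
    \<comment> \<open>The shift replaces branch 0 by branch \<open>m\<close>, which adds
      \<open>I\<close> to the sum; this cancels the increment of \<open>R\<close>.\<close>
    have "(\<Sum>k<m. R (S (x + 1 + real k))) = (\<Sum>k<m. h (Suc k))" by (simp add: h_def add_ac)
    also have "\<dots> = (\<Sum>k<Suc m. h k) - h 0" by (subst sum.lessThan_Suc_shift) simp
    also have "h m = h 0 + I" by (simp add: h_def S_add_degree R_period)
    then have "(\<Sum>k<Suc m. h k) - h 0 = (\<Sum>k<m. h k) + I" by simp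
    finally show "F (x + 1) = F x" by (simp add: F_def R_period h_def)
  qed
  define G where "G x = - F x / \<rho> x" for x
  have perG: "periodic_fun_simple' G"
    using perF per\<rho> by (simp add: G_def periodic_fun_simple'_def)
  have CG: "C_k 4 G"
    unfolding G_def by (intro C_k_divide C_k_minus CF C\<rho>) (use \<rho>_pos in \<open>simp add: less_le\<close>)
  define \<epsilon> where "\<epsilon> x = G (T x)" for x
  have C\<epsilon>: "C_k 4 \<epsilon>" unfolding \<epsilon>_def by (rule C_k_compose[OF CG CT])
  have per\<epsilon>: "periodic_fun_simple' \<epsilon>"
    using periodic_add_int[OF perG, of _ "int m"] by unfold_locales (simp add: \<epsilon>_def degree)
  have \<epsilon>: "C_k_circle 4 \<epsilon>" using C\<epsilon> per\<epsilon> by (simp add: C_k_circle_def)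
  have L2: "L2_circle ((deriv ^^ k) \<epsilon>)" if "k \<le> 4" for k
  proof -
    have "C_k_circle 0 ((deriv ^^ k) \<epsilon>)"
      using C_k_circle_derivs[of 0 k \<epsilon>] C_k_circle_mono[OF \<epsilon> that] by simp
    then show ?thesis
      using C_k_circle_square_integrable by (auto simp: L2_circle_iff C_k_circle_def)
  qed
  have weak: "is_weak_deriv k \<epsilon> ((deriv ^^ k) \<epsilon>)" if "k \<le> 4" for k
    by (rule C_k_circle_is_weak_deriv[OF C_k_circle_mono[OF \<epsilon> that]])
  have sob: "sobolev_H 4 \<epsilon>"
    using sobolev_HI[OF _ L2[of 4] weak[of 4]] L2[of 0] by simp
  have D\<epsilon>: "(\<epsilon> has_real_derivative deriv \<epsilon> x) (at x)"
    and D\<rho>: "(\<rho> has_real_derivative deriv \<rho> x) (at x)"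
    and DT': "(deriv T has_real_derivative deriv (deriv T) x) (at x)" for x
    using C_k_Suc_DERIV[of 0, OF C_k_mono[OF C\<epsilon>]] C_k_Suc_DERIV[of 0, OF C_k_mono[OF C\<rho>]]
      C_k_Suc_DERIV[of 0, OF C_k_deriv[OF C_k_mono[OF CT]]] by simp_all
  define w where "w y = - (\<rho> y * deriv \<epsilon> y / deriv T y) - \<epsilon> y * deriv \<rho> y / deriv T y
               + \<epsilon> y * deriv (deriv T) y / (deriv T y)\<^sup>2 * \<rho> y" for y
  have "periodic_fun_simple' (deriv \<epsilon>)" "periodic_fun_simple' (deriv \<rho>)"
    "periodic_fun_simple' (deriv (deriv T))"
    using periodic_deriv[OF per\<epsilon>] periodic_deriv[OF per\<rho>] periodic_deriv[OF periodic_deriv_T] D\<epsilon> D\<rho> DT'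
    unfolding field_differentiable_def by blast+
  then have perw: "periodic_fun_simple' w"
    using per\<epsilon> per\<rho> periodic_deriv_T by (simp add: w_def periodic_fun_simple'_def)
  \<comment> \<open>\<open>w\<close> is minus the derivative of \<open>H\<close>, and the sum of
    \<open>H\<close> over the branches is L(\<rho> \<epsilon>). The common factor G(T(S(x + k))) =
    G(x) comes out of that sum.\<close>
  define H where "H y = \<rho> y * \<epsilon> y / deriv T y" for y
  have DH: "(H has_real_derivative - w y) (at y)" for y
    unfolding H_def w_def
    by (rule derivative_eq_intros D\<rho> D\<epsilon> DT' refl)+
      (use deriv_T_pos[of y] in \<open>auto simp: field_simps power2_eq_square\<close>)
  have sum_H: "(\<Sum>k<m. H (S (x + real k))) = - F x" for x
  proof -
    have "\<epsilon> (S (x + real k)) = G x" for k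
      using periodic_add_int[OF perG, of x "int k"] by (simp add: \<epsilon>_def)
    then have "(\<Sum>k<m. H (S (x + real k))) = (\<Sum>k<m. G x * (\<rho> (S (x + real k)) / deriv T (S (x + real k))))"
      by (simp add: H_def mult.commute)
    also have "\<dots> = G x * \<rho> x" by (simp only: sum_distrib_left[symmetric] \<rho>_inv)
    also have "\<dots> = - F x" using \<rho>_pos[of x] by (simp add: G_def)
    finally show ?thesis .
  qed
  have response: "\<rho>1 x - transfer_operator T \<rho>1 x = transfer_operator T w x" for x
  proof -
    have "((\<lambda>x. \<Sum>k<m. H (S (x + real k))) has_real_derivative
        (\<Sum>k<m. - w (S (x + real k)) * (1 / deriv T (S (x + real k))))) (at x)"
      by (intro DERIV_sum DERIV_chain2[OF DH DERIV_Sk])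
    then have "((\<lambda>x. - F x) has_real_derivative - transfer_operator T w x) (at x)"
      by (simp add: sum_H transfer_operator_eq[OF perw] sum_negf)
    with DERIV_minus[OF F] show ?thesis by (metis DERIV_unique neg_equal_iff_equal)
  qed
  \<comment> \<open>\<open>w\<close> contains the classical derivative, the equation the chosen weak
    one; they agree at all preimages of almost every x.\<close>
  have "AE y in circle_measure. weak_deriv 1 \<epsilon> y = deriv \<epsilon> y"
    using weak_deriv_AE_eq[OF L2[of 1] weak[of 1]] by simp
  from AE_preimages[OF this] have "response_equation T \<rho> \<rho>1 \<epsilon>"
    unfolding response_equation_def
  proof eventually_elim
    case (elim x)
    then show ?case
      unfolding response unfolding transfer_operator_def by (intro sum.cong) (auto simp: w_def)
  qed
  with sob show ?thesis by blast
qed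

text \<open>At each preimage the summand is linear in the pair formed by the value and the weak
  derivative, while the left side stays fixed because the coefficients add up to 1.\<close>

lemma response_equation_midpoint:
  assumes f: "sobolev_H 4 f" "response_equation T \<rho> \<rho>1 f"
    and g: "sobolev_H 4 g" "response_equation T \<rho> \<rho>1 g"
  shows "response_equation T \<rho> \<rho>1 (\<lambda>x. 1/2 * f x + 1/2 * g x)"
proof -
  let ?h = "\<lambda>x. 1/2 * f x + 1/2 * g x"
  have "AE y in circle_measure. weak_deriv 1 ?h y = 1/2 * weak_deriv 1 f y + 1/2 * weak_deriv 1 g y"
    by (rule sobolev_H_lincomb(2)[OF f(1) g(1)]) auto
  from AE_preimages[OF this] f(2)[unfolded response_equation_def] g(2)[unfolded response_equation_def]
  show ?thesis
    unfolding response_equation_def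
  proof eventually_elim
    case (elim x)
    define W where "W u u' y = (- (\<rho> y * u' / deriv T y) - u * deriv \<rho> y / deriv T y
        + u * deriv (deriv T) y / (deriv T y)\<^sup>2 * \<rho> y) / deriv T y" for u u' y :: real
    have "W (1/2 * u + 1/2 * v) (1/2 * u' + 1/2 * v') y = 1/2 * W u u' y + 1/2 * W v v' y" for u u' v v' y
      by (simp add: W_def add_divide_distrib diff_divide_distrib algebra_simps)
    then have "(\<Sum>y\<in>{y \<in> {0..<1}. T y - x \<in> \<int>}. W (?h y) (weak_deriv 1 ?h y) y) =
        1/2 * (\<Sum>y\<in>{y \<in> {0..<1}. T y - x \<in> \<int>}. W (f y) (weak_deriv 1 f y) y) +
        1/2 * (\<Sum>y\<in>{y \<in> {0..<1}. T y - x \<in> \<int>}. W (g y) (weak_deriv 1 g y) y)"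
      unfolding sum_distrib_left sum.distrib[symmetric] using elim(1) by (intro sum.cong) auto
    then show ?case
      using elim(2,3) unfolding transfer_operator_def[of T "\<lambda>y. _ y + _ y"] W_def by simp
  qed
qed

text \<open>L^2 convergence gives pointwise convergence only along a subsequence and off a null set.
  Subsequences are extracted for the values and then for the derivatives, and for almost every x
  convergence holds at all preimages, so each summand converges while the left side does not depend
  on the index.\<close>

lemma response_equation_limit:
  assumes F: "\<And>i::nat. sobolev_H 4 (F i)" "\<And>i. response_equation T \<rho> \<rho>1 (F i)"
    and f: "sobolev_H 4 f"
    and lim0: "(\<lambda>i. norm_L2 (\<lambda>x. F i x - f x)) \<longlonglongrightarrow> 0"
    and lim1: "(\<lambda>i. norm_L2 (\<lambda>x. weak_deriv 1 (F i) x - weak_deriv 1 f x)) \<longlonglongrightarrow> 0"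
  shows "response_equation T \<rho> \<rho>1 f"
proof -
  have si: "square_integrable circle_measure h" "square_integrable circle_measure (weak_deriv 1 h)"
    if "sobolev_H 4 h" for h
    using that weak_deriv_works(1)[OF that, of 1] by (auto simp: sobolev_H_def L2_circle_iff)
  obtain r where r: "strict_mono (r :: nat \<Rightarrow> nat)"
    "AE x in circle_measure. (\<lambda>i. F (r i) x - f x) \<longlonglongrightarrow> 0"
    using l2norm_tendsto_0_AE_subseq[OF square_integrable_diff[OF si(1)[OF F(1)] si(1)[OF f]], of "\<lambda>i. i"] lim0
    unfolding norm_L2_eq by blast
  have "(\<lambda>i. norm_L2 (\<lambda>x. weak_deriv 1 (F (r i)) x - weak_deriv 1 f x)) \<longlonglongrightarrow> 0"
    using LIMSEQ_subseq_LIMSEQ[OF lim1 r(1)] by (simp add: o_def)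
  then obtain s where s: "strict_mono (s :: nat \<Rightarrow> nat)"
    "AE x in circle_measure. (\<lambda>i. weak_deriv 1 (F (r (s i))) x - weak_deriv 1 f x) \<longlonglongrightarrow> 0"
    using l2norm_tendsto_0_AE_subseq[OF square_integrable_diff[OF si(2)[OF F(1)] si(2)[OF f]], of r]
    unfolding norm_L2_eq by blast
  have "AE y in circle_measure. (\<lambda>i. F (r (s i)) y) \<longlonglongrightarrow> f y \<and>
      (\<lambda>i. weak_deriv 1 (F (r (s i))) y) \<longlonglongrightarrow> weak_deriv 1 f y"
    using r(2) s(2)
  proof eventually_elim
    case (elim y)
    then show ?case
      using LIMSEQ_subseq_LIMSEQ[OF elim(1) s(1)] by (auto simp: o_def intro: LIM_zero_cancel)
  qed
  note AE_preimages[OF this]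
  moreover have "AE x in circle_measure. \<forall>i. \<rho>1 x - transfer_operator T \<rho>1 x =
      transfer_operator T (\<lambda>y. - (\<rho> y * weak_deriv 1 (F (r (s i))) y / deriv T y)
               - F (r (s i)) y * deriv \<rho> y / deriv T y
               + F (r (s i)) y * deriv (deriv T) y / (deriv T y)\<^sup>2 * \<rho> y) x"
    using F(2) by (auto simp: AE_all_countable response_equation_def)
  ultimately show ?thesis
    unfolding response_equation_def
  proof eventually_elim
    case (elim x)
    have "(\<lambda>i. transfer_operator T (\<lambda>y. - (\<rho> y * weak_deriv 1 (F (r (s i))) y / deriv T y)
               - F (r (s i)) y * deriv \<rho> y / deriv T y
               + F (r (s i)) y * deriv (deriv T) y / (deriv T y)\<^sup>2 * \<rho> y) x)
        \<longlonglongrightarrow> transfer_operator T (\<lambda>y. - (\<rho> y * weak_deriv 1 f y / deriv T y)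
               - f y * deriv \<rho> y / deriv T y
               + f y * deriv (deriv T) y / (deriv T y)\<^sup>2 * \<rho> y) x"
      unfolding transfer_operator_def
      using elim(1) deriv_T_pos by (intro tendsto_intros) (auto simp: less_le)
    then show ?case
      unfolding elim(2)[rule_format, symmetric] by (simp add: LIMSEQ_const_iff)
  qed
qed

end

lemma expanding_circle_map_lift:
  assumes "expanding_circle_map T"
  obtains m c where "expanding_lift T m c"
  using assms by (auto simp: expanding_circle_map_def expanding_lift_def)

theorem proposition4p5:
  fixes T0 \<rho> \<rho>1 :: "real \<Rightarrow> real" and a b c d :: real
  assumes "expanding_circle_map T0" and "C_k 5 T0"
    and "invariant_density T0 \<rho>" and "C_k_circle 4 \<rho>"
    and "C_k_circle 3 \<rho>1"
    and "a \<ge> 0" and "b \<ge> 0" and "c \<ge> 0" and "d > 0"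
  shows "\<exists>\<epsilon>. is_arg_min (norm_abcd a b c d)
                (\<lambda>f. sobolev_H 4 f \<and> response_equation T0 \<rho> \<rho>1 f) \<epsilon> \<and>
             (\<forall>\<epsilon>'. is_arg_min (norm_abcd a b c d)
                (\<lambda>f. sobolev_H 4 f \<and> response_equation T0 \<rho> \<rho>1 f) \<epsilon>' \<longrightarrow>
                (AE x in circle_measure. \<epsilon>' x = \<epsilon> x))"
proof -
  obtain m q where "expanding_lift T0 m q"
    using assms(1) by (rule expanding_circle_map_lift)
  then interpret expanding_lift T0 m q .
  \<comment> \<open>Order 0 carries weight 1. Every index above 3 receives \<open>d\<close>, so the
    weights are nonnegative at all indices.\<close>
  define w where "w j = (if j = 0 then 1 else if j = 1 then a else if j = 2 then b
    else if j = 3 then c else d)" for j :: nat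
  have norm: "norm_abcd a b c d = sobolev_norm w 4"
    by (simp add: fun_eq_iff norm_abcd_def sobolev_norm_def sobolev_deriv_def w_def eval_nat_numeral)
  obtain \<epsilon>0 where \<epsilon>0: "sobolev_H 4 \<epsilon>0 \<and> response_equation T0 \<rho> \<rho>1 \<epsilon>0"
    using response_equation_solvable[OF assms(2-5)] by blast
  show ?thesis
    unfolding norm
  proof (rule sobolev_norm_unique_minimizer)
    show "w j \<ge> 0" for j using assms(6-9) by (simp add: w_def)
    show "w 0 > 0" "w 4 > 0" "(1::nat) \<le> 4" using assms(9) by (simp_all add: w_def)
    show "sobolev_H 4 \<epsilon>0 \<and> response_equation T0 \<rho> \<rho>1 \<epsilon>0" by (rule \<epsilon>0)
  next
    fix f g assume "sobolev_H 4 f \<and> response_equation T0 \<rho> \<rho>1 f" "sobolev_H 4 g \<and> response_equation T0 \<rho> \<rho>1 g"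
    then show "sobolev_H 4 (\<lambda>x. 1/2 * f x + 1/2 * g x) \<and> response_equation T0 \<rho> \<rho>1 (\<lambda>x. 1/2 * f x + 1/2 * g x)"
      by (intro conjI sobolev_H_lincomb(1) response_equation_midpoint) blast+
  next
    fix F :: "nat \<Rightarrow> real \<Rightarrow> real" and f
    assume F: "\<And>i. sobolev_H 4 (F i) \<and> response_equation T0 \<rho> \<rho>1 (F i)" and f: "sobolev_H 4 f"
      and lim: "\<And>j. j \<le> 4 \<Longrightarrow> (\<lambda>i. norm_L2 (\<lambda>x. sobolev_deriv j (F i) x - sobolev_deriv j f x)) \<longlonglongrightarrow> 0"
    have "response_equation T0 \<rho> \<rho>1 f"
      by (rule response_equation_limit[OF F[THEN conjunct1] F[THEN conjunct2] f])
        (use lim[of 0] lim[of 1] in \<open>simp_all add: sobolev_deriv_def\<close>)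
    with f show "sobolev_H 4 f \<and> response_equation T0 \<rho> \<rho>1 f" by blast
  qed blast
qed

end
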